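(* Let $d\ge1$, let $A \in \mathrm{GL}(2d,\mathbb R)$ and suppose that $$A^T J A = \begin{pmatrix} 0 & K \\ -K^T & 0 \end{pmatrix} \quad \text{for some } K \in \mathrm{GL}(d,\mathbb R).$$ Then the lattice $A\mathbb Z^{2d}$ is symplectically related to the separable lattice $\begin{pmatrix} I & 0 \\ 0 & K \end{pmatrix} \mathbb Z^{2d}$, and the structure of Gabor systems over $A \mathbb Z^{2d}$ is unitarily equivalent to the structure of Gabor systems over $\begin{pmatrix} I & 0 \\ 0 & K \end{pmatrix} \mathbb Z^{2d}$.
   Context: $J = \begin{pmatrix} 0 & I \\ -I & 0\end{pmatrix}$ is the standard $2d\times 2d$ symplectic matrix ($I$ the $d\times d$ identity); $\mathrm{Sp}(2d,\mathbb R)=\{S : S^TJS=J\}$. A lattice in $\mathbb R^{2d}$ is a set $A\mathbb Z^{2d}$ with $A\in\mathrm{GL}(2d,\mathbb R)$; it is separable if $A$ can be chosen block diagonal with two invertible $d\times d$ blocks. Two lattices $\Lambda,\Lambda'$ are symplectically related if $\Lambda'=S\Lambda$ for some $S\in\mathrm{Sp}(2d,\mathbb R)$. For $z=(x,\omega)\in\mathbb R^{d}\times\mathbb R^d$, $\pi(z)f(t)=e^{2\pi i t\cdot\omega}f(t-x)$ on $L^2(\mathbb R^d)$. For a lattice $\Lambda$ and $g\in L^2(\mathbb R^d)$ the Gabor system is $\mathcal G(g,\Lambda)=\{\pi(z)g : z\in\Lambda\}$; it is a Bessel sequence if there is $C>0$ with $\sum_{z\in\Lambda}|\langle f,\pi(z)g\rangle|^2\le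 C\|f\|^2$ for all $f\in L^2(\mathbb R^d)$. If $\mathcal G(g,\Lambda)$ and $\mathcal G(h,\Lambda)$ are Bessel sequences, the frame operator is $S^\Lambda_{g,h}f=\sum_{z\in\Lambda}\langle f,\pi(z)g\rangle\pi(z)h$ on $L^2(\mathbb R^d)$. Inner products are linear in the first argument. The structures of Gabor systems (Gabor structures) over lattices $\Lambda$ and $\Lambda'$ are unitarily equivalent if there exists a unitary operator $U$ on $L^2(\mathbb R^d)$ such that, for all $g,h\in L^2(\mathbb R^d)$: (i) $\mathcal G(Ug,\Lambda')$ is a Bessel sequence if and only if $\mathcal G(g,\Lambda)$ is a Bessel sequence; and (ii) $S^{\Lambda'}_{Ug,Uh}=U S^\Lambda_{g,h}U^{-1}$ whenever $\mathcal G(g,\Lambda)$ and $\mathcal G(h,\Lambda)$ are Bessel sequences. *)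

theory Defs
  imports "HOL-Analysis.Analysis"
begin

section \<open>The complex Hilbert space of square-integrable functions\<close>

definition square_integrable :: "('a::euclidean_space \<Rightarrow> complex) \<Rightarrow> bool" where
  "square_integrable f \<longleftrightarrow> f \<in> borel_measurable lborel \<and> integrable lborel (\<lambda>t. (cmod (f t))\<^sup>2)"

definition l2_rel :: "('a::euclidean_space \<Rightarrow> complex) \<Rightarrow> ('a \<Rightarrow> complex) \<Rightarrow> bool" where
  "l2_rel f g \<longleftrightarrow> square_integrable f \<and> square_integrable g \<and> (AE t in lborel. f t = g t)"

lemma square_integrable_measurable [measurable_dest]:
  "square_integrable f \<Longrightarrow> f \<in> borel_measurable lborel"
  by (simp add: square_integrable_def)

lemma cnj_borel_measurable [measurable]: "cnj \<in> borel_measurable borel"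
  by (intro borel_measurable_continuous_onI continuous_intros)

lemma square_integrable_zero: "square_integrable (\<lambda>t. 0)"
  by (simp add: square_integrable_def)

lemma square_integrable_mult:
  assumes "square_integrable f"
  shows "square_integrable (\<lambda>t. c * f t)"
  using assms by (auto simp: square_integrable_def norm_mult power_mult_distrib)

lemma square_integrable_add:
  fixes f g :: "'a::euclidean_space \<Rightarrow> complex"
  assumes "square_integrable f" "square_integrable g"
  shows "square_integrable (\<lambda>t. f t + g t)"
proof -
  note [measurable] = assms[THEN square_integrable_measurable]
  have int: "integrable lborel (\<lambda>t. 2 * (cmod (f t))\<^sup>2 + 2 * (cmod (g t))\<^sup>2)"
    using assms by (auto simp: square_integrable_def)
  have "(cmod (f t + g t))\<^sup>2 \<le> 2 * (cmod (f t))\<^sup>2 + 2 * (cmod (g t))\<^sup>2" for t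
  proof -
    have "(cmod (f t + g t))\<^sup>2 \<le> (cmod (f t) + cmod (g t))\<^sup>2"
      by (intro power_mono norm_triangle_ineq) auto
    also have "\<dots> \<le> 2 * (cmod (f t))\<^sup>2 + 2 * (cmod (g t))\<^sup>2"
      using sum_squares_bound[of "cmod (f t)" "cmod (g t)"] by (simp add: power2_sum)
    finally show ?thesis .
  qed
  then have "integrable lborel (\<lambda>t. (cmod (f t + g t))\<^sup>2)"
    by (intro Bochner_Integration.integrable_bound[OF int]) auto
  then show ?thesis
    by (simp add: square_integrable_def)
qed

lemma square_integrable_product:
  fixes f g :: "'a::euclidean_space \<Rightarrow> complex"
  assumes "square_integrable f" "square_integrable g"
  shows "integrable lborel (\<lambda>t. f t * cnj (g t))"
proof -
  note [measurable] = assms[THEN square_integrable_measurable]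
  have int: "integrable lborel (\<lambda>t. (cmod (f t))\<^sup>2 + (cmod (g t))\<^sup>2)"
    using assms by (auto simp: square_integrable_def)
  have "cmod (f t) * cmod (g t) \<le> (cmod (f t))\<^sup>2 + (cmod (g t))\<^sup>2" for t
    using sum_squares_bound[of "cmod (f t)" "cmod (g t)"]
      mult_nonneg_nonneg[OF norm_ge_zero[of "f t"] norm_ge_zero[of "g t"]] by linarith
  then show ?thesis
    by (intro Bochner_Integration.integrable_bound[OF int]) (auto simp: norm_mult)
qed

quotient_type (overloaded) 'a L2 = "'a::euclidean_space \<Rightarrow> complex" / partial: l2_rel
proof (rule part_equivpI)
  show "\<exists>f. l2_rel f f"
    by (rule exI[of _ "\<lambda>t. 0"]) (simp add: l2_rel_def square_integrable_zero)
  show "symp l2_rel"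
    by (auto simp: symp_def l2_rel_def elim: AE_mp)
  show "transp l2_rel"
    by (auto simp: transp_def l2_rel_def)
qed

instantiation L2 :: (euclidean_space) real_vector
begin

lift_definition zero_L2 :: "'a L2" is "\<lambda>t. 0"
  by (simp add: l2_rel_def square_integrable_zero)

lift_definition plus_L2 :: "'a L2 \<Rightarrow> 'a L2 \<Rightarrow> 'a L2" is "\<lambda>f g t. f t + g t"
  by (auto simp: l2_rel_def square_integrable_add)

lift_definition uminus_L2 :: "'a L2 \<Rightarrow> 'a L2" is "\<lambda>f t. - f t"
  using square_integrable_mult[where c = "-1"] by (auto simp: l2_rel_def)

definition minus_L2 :: "'a L2 \<Rightarrow> 'a L2 \<Rightarrow> 'a L2" where
  "minus_L2 f g = f + - g"

lift_definition scaleR_L2 :: "real \<Rightarrow> 'a L2 \<Rightarrow> 'a L2" is "\<lambda>r f t. of_real r * f t"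
  by (auto simp: l2_rel_def square_integrable_mult)

instance
proof
  fix f g h :: "'a L2" and r s :: real
  show "f + g + h = f + (g + h)"
    by transfer (auto simp: l2_rel_def add.assoc intro!: square_integrable_add)
  show "f + g = g + f"
    by transfer (auto simp: l2_rel_def add.commute intro!: square_integrable_add)
  show "0 + f = f"
    by transfer (auto simp: l2_rel_def)
  show "- f + f = 0"
    by transfer (auto simp: l2_rel_def square_integrable_zero)
  show "f - g = f + - g"
    by (rule minus_L2_def)
  show "r *\<^sub>R (f + g) = r *\<^sub>R f + r *\<^sub>R g"
    by transfer (auto simp: l2_rel_def distrib_left
        intro!: square_integrable_add square_integrable_mult)
  show "(r + s) *\<^sub>R f = r *\<^sub>R f + s *\<^sub>R f"
    by transfer (auto simp: l2_rel_def distrib_right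
        intro!: square_integrable_add square_integrable_mult)
  show "r *\<^sub>R s *\<^sub>R f = (r * s) *\<^sub>R f"
    by transfer (auto simp: l2_rel_def mult.assoc intro!: square_integrable_mult)
  show "1 *\<^sub>R f = f"
    by transfer (auto simp: l2_rel_def)
qed

end

lift_definition scaleC :: "complex \<Rightarrow> 'a::euclidean_space L2 \<Rightarrow> 'a L2" (infixr "*\<^sub>C" 75)
  is "\<lambda>c f t. c * f t"
  by (auto simp: l2_rel_def square_integrable_mult)

lift_definition cinner :: "'a::euclidean_space L2 \<Rightarrow> 'a L2 \<Rightarrow> complex"
  is "\<lambda>f g. (\<integral>t. f t * cnj (g t) \<partial>lborel)"
proof -
  fix f f' g g' :: "'a \<Rightarrow> complex"
  assume f: "l2_rel f f'" and g: "l2_rel g g'"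
  from f have [measurable]: "f \<in> borel_measurable lborel" "f' \<in> borel_measurable lborel"
    by (auto simp: l2_rel_def square_integrable_def)
  from g have [measurable]: "g \<in> borel_measurable lborel" "g' \<in> borel_measurable lborel"
    by (auto simp: l2_rel_def square_integrable_def)
  have "AE t in lborel. f t = f' t" "AE t in lborel. g t = g' t"
    using f g by (auto simp: l2_rel_def)
  then show "(\<integral>t. f t * cnj (g t) \<partial>lborel) = (\<integral>t. f' t * cnj (g' t) \<partial>lborel)"
    by (intro integral_cong_AE) auto
qed

lemma cinner_commute: "cinner g f = cnj (cinner f g)"
  by transfer (simp flip: Bochner_Integration.integral_cnj add: mult.commute)

lemma cinner_add_left: "cinner (f + g) h = cinner f h + cinner g h"
  by transfer (simp add: l2_rel_def distrib_right square_integrable_product)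

lemma cinner_scaleC_left: "cinner (c *\<^sub>C f) g = c * cinner f g"
  by transfer (simp add: mult.assoc)

lemma scaleR_eq_scaleC: "r *\<^sub>R (f :: 'a::euclidean_space L2) = of_real r *\<^sub>C f"
  by transfer (simp add: l2_rel_def square_integrable_mult)

lemma cinner_self_rep:
  "(\<integral>t. f t * cnj (f t) \<partial>lborel) = of_real (\<integral>t. (cmod (f t))\<^sup>2 \<partial>lborel)"
  unfolding integral_complex_of_real[symmetric]
  by (intro Bochner_Integration.integral_cong refl) (rule complex_norm_square[symmetric])

instantiation L2 :: (euclidean_space) real_inner
begin

definition inner_L2 :: "'a L2 \<Rightarrow> 'a L2 \<Rightarrow> real" where
  "inner_L2 f g = Re (cinner f g)"

definition norm_L2 :: "'a L2 \<Rightarrow> real" where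
  "norm_L2 f = sqrt (inner f f)"

definition sgn_L2 :: "'a L2 \<Rightarrow> 'a L2" where
  "sgn_L2 f = f /\<^sub>R norm f"

definition dist_L2 :: "'a L2 \<Rightarrow> 'a L2 \<Rightarrow> real" where
  "dist_L2 f g = norm (f - g)"

definition uniformity_L2 :: "('a L2 \<times> 'a L2) filter" where
  "uniformity_L2 = (INF e\<in>{0<..}. principal {(f, g). dist f g < e})"

definition open_L2 :: "'a L2 set \<Rightarrow> bool" where
  "open_L2 S \<longleftrightarrow> (\<forall>f\<in>S. \<forall>\<^sub>F (f', g) in uniformity. f' = f \<longrightarrow> g \<in> S)"

instance
proof
  fix f g h :: "'a L2" and r :: real and S :: "'a L2 set"
  show "inner f g = inner g f"
    unfolding inner_L2_def by (subst cinner_commute) simp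
  show "inner (f + g) h = inner f h + inner g h"
    by (simp add: inner_L2_def cinner_add_left)
  show "inner (r *\<^sub>R f) g = r * inner f g"
    by (simp add: inner_L2_def scaleR_eq_scaleC cinner_scaleC_left)
  show "0 \<le> inner f f"
    unfolding inner_L2_def by transfer (simp add: cinner_self_rep)
  show "inner f f = 0 \<longleftrightarrow> f = 0"
    unfolding inner_L2_def
  proof transfer
    fix f :: "'a \<Rightarrow> complex"
    assume "l2_rel f f"
    then show "Re (\<integral>t. f t * cnj (f t) \<partial>lborel) = 0 \<longleftrightarrow> l2_rel f (\<lambda>t. 0)"
      unfolding cinner_self_rep
      by (auto simp: l2_rel_def square_integrable_zero square_integrable_def
          integral_nonneg_eq_0_iff_AE)
  qed
qed (simp_all add: norm_L2_def sgn_L2_def dist_L2_def uniformity_L2_def open_L2_def)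

end

definition unitary_op :: "('a::euclidean_space L2 \<Rightarrow> 'a L2) \<Rightarrow> bool" where
  "unitary_op U \<longleftrightarrow>
     (\<forall>f g. U (f + g) = U f + U g) \<and> (\<forall>c f. U (c *\<^sub>C f) = c *\<^sub>C U f) \<and>
     surj U \<and> (\<forall>f g. cinner (U f) (U g) = cinner f g)"


section \<open>Symplectic matrices and lattices\<close>

text \<open>
  The index type \<^typ>\<open>'d + 'd\<close> realises the splitting of a vector of length 2d into two
  halves: \<^term>\<open>Inl\<close> indexes the first d coordinates and \<^term>\<open>Inr\<close> the last d.
\<close>

definition block_mat ::
  "'a^'n^'m \<Rightarrow> 'a^'p^'m \<Rightarrow> 'a^'n^'q \<Rightarrow> 'a^'p^'q \<Rightarrow> 'a^('n + 'p)^('m + 'q)" where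
  "block_mat A B C D = (\<chi> i j.
     case i of
       Inl k \<Rightarrow> (case j of Inl l \<Rightarrow> A $ k $ l | Inr l \<Rightarrow> B $ k $ l)
     | Inr k \<Rightarrow> (case j of Inl l \<Rightarrow> C $ k $ l | Inr l \<Rightarrow> D $ k $ l))"

definition symp_J :: "real^('d::finite + 'd)^('d + 'd)" where
  "symp_J = block_mat 0 (mat 1) (- mat 1) 0"

definition symplectic :: "real^('d::finite + 'd)^('d + 'd) \<Rightarrow> bool" where
  "symplectic S \<longleftrightarrow> transpose S ** symp_J ** S = symp_J"

definition lattice_of :: "real^'n^'n::finite \<Rightarrow> (real^'n) set" where
  "lattice_of A = (\<lambda>m. A *v m) ` {m. \<forall>i. m $ i \<in> \<int>}"

definition separable_lattice :: "(real^('d::finite + 'd)) set \<Rightarrow> bool" where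
  "separable_lattice \<Lambda> \<longleftrightarrow>
     (\<exists>B C :: real^'d^'d. invertible B \<and> invertible C \<and> \<Lambda> = lattice_of (block_mat B 0 0 C))"

definition symplectically_related ::
  "(real^('d::finite + 'd)) set \<Rightarrow> (real^('d + 'd)) set \<Rightarrow> bool" where
  "symplectically_related \<Lambda> \<Lambda>' \<longleftrightarrow> (\<exists>S. symplectic S \<and> \<Lambda>' = (\<lambda>z. S *v z) ` \<Lambda>)"


section \<open>Gabor systems\<close>

definition time_part :: "real^('d::finite + 'd) \<Rightarrow> real^'d" where
  "time_part z = (\<chi> i. z $ Inl i)"

definition freq_part :: "real^('d::finite + 'd) \<Rightarrow> real^'d" where
  "freq_part z = (\<chi> i. z $ Inr i)"

lift_definition tf_shift :: "real^('d::finite + 'd) \<Rightarrow> (real^'d) L2 \<Rightarrow> (real^'d) L2"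
  is "\<lambda>z f t. cis (2 * pi * (t \<bullet> freq_part z)) * f (t - time_part z)"
proof -
  fix z :: "real^('d + 'd)" and f g :: "real^'d \<Rightarrow> complex"
  assume fg: "l2_rel f g"
  let ?T = "\<lambda>t :: real^'d. - time_part z + t"
  let ?M = "\<lambda>h t. cis (2 * pi * (t \<bullet> freq_part z)) * h (t - time_part z) :: complex"
  have distr: "distr lborel borel ?T = lborel"
    by (rule lborel_distr_plus)
  have cis_meas: "(\<lambda>t. cis (2 * pi * (t \<bullet> freq_part z))) \<in> borel_measurable borel"
    by (intro borel_measurable_continuous_onI continuous_intros)
  have si: "square_integrable (?M h)" if h: "square_integrable h" for h
  proof -
    have [measurable]: "h \<in> borel_measurable borel"
      using h by (simp add: square_integrable_def)
    note [measurable] = cis_meas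
    have "integrable (distr lborel borel ?T) (\<lambda>t. (cmod (h t))\<^sup>2)"
      using h unfolding distr square_integrable_def by simp
    then have "integrable lborel (\<lambda>t. (cmod (h (?T t)))\<^sup>2)"
      by (subst (asm) integrable_distr_eq) auto
    then show ?thesis
      by (simp add: square_integrable_def norm_mult)
  qed
  have "AE t in distr lborel borel ?T. f t = g t"
    using fg unfolding distr l2_rel_def by simp
  then have "AE t in lborel. f (?T t) = g (?T t)"
    by (rule AE_distrD[rotated]) simp
  then have "AE t in lborel. ?M f t = ?M g t"
    by eventually_elim simp
  then show "l2_rel (?M f) (?M g)"
    using fg si by (simp add: l2_rel_def)
qed

text \<open>The Gabor system is treated as the family \<open>\<lambda>z. tf_shift z g\<close> indexed by \<open>z \<in> \<Lambda>\<close>.\<close>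

definition gabor_bessel :: "(real^'d::finite) L2 \<Rightarrow> (real^('d + 'd)) set \<Rightarrow> bool" where
  "gabor_bessel g \<Lambda> \<longleftrightarrow> (\<exists>C>0. \<forall>f.
     (\<lambda>z. (cmod (cinner f (tf_shift z g)))\<^sup>2) summable_on \<Lambda> \<and>
     (\<Sum>\<^sub>\<infinity>z\<in>\<Lambda>. (cmod (cinner f (tf_shift z g)))\<^sup>2) \<le> C * (norm f)\<^sup>2)"

text \<open>The series is an unconditional sum in the \<open>L2\<close>-norm topology.\<close>

definition frame_operator ::
  "(real^('d::finite + 'd)) set \<Rightarrow> (real^'d) L2 \<Rightarrow> (real^'d) L2 \<Rightarrow> (real^'d) L2 \<Rightarrow> (real^'d) L2" where
  "frame_operator \<Lambda> g h f = (\<Sum>\<^sub>\<infinity>z\<in>\<Lambda>. cinner f (tf_shift z g) *\<^sub>C tf_shift z h)"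

definition gabor_unitarily_equivalent ::
  "(real^('d::finite + 'd)) set \<Rightarrow> (real^('d + 'd)) set \<Rightarrow> bool" where
  "gabor_unitarily_equivalent \<Lambda> \<Lambda>' \<longleftrightarrow> (\<exists>U :: (real^'d) L2 \<Rightarrow> (real^'d) L2. unitary_op U \<and>
     (\<forall>g. gabor_bessel (U g) \<Lambda>' \<longleftrightarrow> gabor_bessel g \<Lambda>) \<and>
     (\<forall>g h. gabor_bessel g \<Lambda> \<longrightarrow> gabor_bessel h \<Lambda> \<longrightarrow>
        frame_operator \<Lambda>' (U g) (U h) = U \<circ> frame_operator \<Lambda> g h \<circ> inv U))"

end

theory Submission
  imports Defs "HOL-Probability.Probability"
begin

text \<open>
  The matrix \<open>S = block_mat (mat 1) 0 0 K ** A\<^sup>-\<^sup>1\<close> is symplectic and maps one lattice onto the other, so it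
  suffices to find a unitary \<open>U\<close> with \<open>U \<pi>(z) = c(z) \<pi>(S z) U\<close> for phases \<open>c(z)\<close>; both conditions of
  unitary equivalence then follow termwise. Lower triangular and block diagonal \<open>S\<close> come from chirp
  multiplications and dilations. For an orthogonal symplectic \<open>S\<close>, such as \<open>symp_J\<close>, the operator is obtained
  without Plancherel's theorem: the inner products of the time-frequency shifts of a Gaussian depend
  only on the symplectic form and the norm, so \<open>S\<close> permutes this total family isometrically. Every
  symplectic matrix with invertible upper left block factors into these, and the general
  case reduces to it by adding a suitable multiple of the lower rows to the upper ones.
\<close>

section \<open>Completeness of the Hilbert space\<close>

text \<open>\<open>A\<close> and \<open>block_mat (mat 1) 0 0 K\<close> pull the form
  \<open>symp_J\<close> back to the same matrix, and this is exactly why \<open>S\<close> is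
  symplectic. The phases are harmless: each Gabor coefficient picks up a phase, and the vector that
  it multiplies picks up the conjugate one.

  The obstacle is the operator for \<open>symp_J\<close>: chirps and dilations act by multiplication
  and substitution and never exchange time and frequency. The Gram matrix argument that supplies it
  shapes the analytic half of the proof. The isometry is at first known only on finite combinations
  of shifted Gaussians, so extending it needs completeness of \<open>L2\<close> and density of their
  span; density comes down to the injectivity of the Fourier transform on integrable functions. The
  width \<open>pi\<close> of the Gaussian is the one that balances time and frequency under the
  \<open>2 * pi\<close> convention of \<open>tf_shift\<close>; only then do the inner products
  depend on the norm of the phase space point alone.\<close>

lemma L2_cases:
  obtains f where "square_integrable f" "x = abs_L2 f"
  using Quotient3_rep_reflp[OF Quotient3_L2, of x] Quotient3_abs_rep[OF Quotient3_L2, of x]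
  by (metis l2_rel_def)

lemma l2_rel_refl: "square_integrable f \<Longrightarrow> l2_rel f f"
  by (simp add: l2_rel_def)

lemma abs_L2_eq_iff:
  assumes "square_integrable f" "square_integrable g"
  shows "abs_L2 f = abs_L2 g \<longleftrightarrow> (AE t in lborel. f t = g t)"
  using Quotient3_rel[OF Quotient3_L2, of f g] assms by (auto simp: l2_rel_def)

lemma square_integrable_uminus: "square_integrable f \<Longrightarrow> square_integrable (\<lambda>t. - f t)"
  using square_integrable_mult[where c = "-1"] by simp

lemma square_integrable_diff:
  "square_integrable f \<Longrightarrow> square_integrable g \<Longrightarrow> square_integrable (\<lambda>t. f t - g t)"
  using square_integrable_add[OF _ square_integrable_uminus] by auto

lemma abs_L2_diff:
  assumes "square_integrable f" "square_integrable g"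
  shows "abs_L2 f - abs_L2 g = abs_L2 (\<lambda>t. f t - g t)"
  using assms
  by (simp add: minus_L2_def uminus_L2.abs_eq plus_L2.abs_eq l2_rel_refl square_integrable_uminus)

lemma cinner_abs_L2:
  "square_integrable f \<Longrightarrow> square_integrable g \<Longrightarrow>
     cinner (abs_L2 f) (abs_L2 g) = (\<integral>t. f t * cnj (g t) \<partial>lborel)"
  by (simp add: cinner.abs_eq l2_rel_refl)

text \<open>Stated in \<open>ennreal\<close>, where Fatou's lemma applies before a limit function is
  known to be square integrable.\<close>

lemma norm_abs_L2:
  assumes "square_integrable f"
  shows "ennreal ((norm (abs_L2 f))\<^sup>2) = (\<integral>\<^sup>+t. ennreal ((cmod (f t))\<^sup>2) \<partial>lborel)"
  using assms
  by (subst nn_integral_eq_integral)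
     (auto simp: norm_L2_def inner_L2_def cinner_abs_L2 cinner_self_rep square_integrable_def)

lemma square_integrableI:
  assumes "f \<in> borel_measurable lborel" "(\<integral>\<^sup>+t. ennreal ((cmod (f t))\<^sup>2) \<partial>lborel) < \<infinity>"
  shows "square_integrable f"
  unfolding square_integrable_def using assms
  by (auto intro!: integrableI_bounded)

text \<open>Riesz--Fischer. Weighting the squared increments by \<open>2 ^ n\<close> gives almost everywhere
  absolute convergence without Minkowski's inequality.\<close>

lemma AE_convergent_of_rapidly_Cauchy:
  fixes f :: "nat \<Rightarrow> 'a::euclidean_space \<Rightarrow> complex"
  assumes meas [measurable]: "\<And>n. f n \<in> borel_measurable lborel"
    and bound: "\<And>n. (\<integral>\<^sup>+t. ennreal ((cmod (f (Suc n) t - f n t))\<^sup>2) \<partial>lborel) \<le> ennreal ((1/4) ^ n)"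
  shows "AE t in lborel. convergent (\<lambda>n. f n t)"
proof -
  define h where "h n t = (cmod (f (Suc n) t - f n t))\<^sup>2" for n t
  have [measurable]: "h n \<in> borel_measurable lborel" for n
    unfolding h_def by measurable
  have "(\<integral>\<^sup>+t. (\<Sum>n. ennreal (2 ^ n) * ennreal (h n t)) \<partial>lborel)
      = (\<Sum>n. ennreal (2 ^ n) * (\<integral>\<^sup>+t. ennreal (h n t) \<partial>lborel))"
    by (simp add: nn_integral_suminf nn_integral_cmult)
  also have "\<dots> \<le> (\<Sum>n. ennreal ((1/2) ^ n))"
  proof (intro suminf_le summableI)
    fix n
    have "ennreal (2 ^ n) * (\<integral>\<^sup>+t. ennreal (h n t) \<partial>lborel) \<le> ennreal (2 ^ n) * ennreal ((1/4) ^ n)"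
      unfolding h_def by (intro mult_left_mono bound) auto
    also have "\<dots> = ennreal ((1/2) ^ n)"
      by (simp flip: ennreal_mult power_mult_distrib)
    finally show "ennreal (2 ^ n) * (\<integral>\<^sup>+t. ennreal (h n t) \<partial>lborel) \<le> ennreal ((1/2) ^ n)" .
  qed
  also have "\<dots> < \<infinity>"
    by (subst suminf_ennreal_eq[where x = 2]) (auto intro: sums_If_finite simp: power_one_over[symmetric] geometric_sums[of "1/2 :: real", simplified])
  finally have "(\<integral>\<^sup>+t. (\<Sum>n. ennreal (2 ^ n) * ennreal (h n t)) \<partial>lborel) \<noteq> \<infinity>"
    by simp
  then have "AE t in lborel. (\<Sum>n. ennreal (2 ^ n) * ennreal (h n t)) \<noteq> \<infinity>"
    by (intro nn_integral_PInf_AE) auto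
  then show ?thesis
  proof eventually_elim
    fix t assume "(\<Sum>n. ennreal (2 ^ n) * ennreal (h n t)) \<noteq> \<infinity>"
    then have "summable (\<lambda>n. 2 ^ n * h n t)"
      by (intro summable_suminf_not_top)
         (auto simp: h_def ennreal_mult[symmetric])
    moreover have "summable (\<lambda>n. (1/2 :: real) ^ n)"
      by (rule summable_geometric) simp
    ultimately have "summable (\<lambda>n. (1/2) ^ n + 2 ^ n * h n t)"
      by (intro summable_add) auto
    then have "summable (\<lambda>n. f (Suc n) t - f n t)"
    proof (rule summable_comparison_test'[where N = 0])
      fix n :: nat
      let ?c = "cmod (f (Suc n) t - f n t)"
      \<comment> \<open>This is \<open>x \<le> 1 + x^2\<close> at \<open>x = 2 ^ n * ?c\<close>,
        divided by \<open>2 ^ n\<close>. It trades the absolute increment for a geometric term plus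
        the weighted square, both of which are summable.\<close>
      have "?c \<le> (1/2) ^ n + 2 ^ n * ?c\<^sup>2"
      proof -
        have "(2::real) ^ n * ?c \<le> 1 + (2 ^ n * ?c)\<^sup>2"
          using sum_squares_bound[of 1 "2 ^ n * ?c"] by (simp add: power2_eq_square) (smt (verit) mult_nonneg_nonneg norm_ge_zero zero_le_power)
        then have "(1/2) ^ n * (2 ^ n * ?c) \<le> (1/2) ^ n * (1 + (2 ^ n * ?c)\<^sup>2)"
          by (intro mult_left_mono) auto
        then show ?thesis
          by (simp add: power2_eq_square power_one_over field_simps)
      qed
      then show "norm (f (Suc n) t - f n t) \<le> (1/2) ^ n + 2 ^ n * h n t"
        by (simp add: h_def)
    qed
    then have "convergent (\<lambda>n. \<Sum>i<n. f (Suc i) t - f i t)"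
      by (simp add: summable_iff_convergent)
    then have "convergent (\<lambda>n. f n t - f 0 t)"
      by (subst (asm) sum_lessThan_telescope)
    then show "convergent (\<lambda>n. f n t)"
      by (simp add: convergent_diff_const_right_iff)
  qed
qed

text \<open>A rapidly Cauchy subsequence of representatives converges almost everywhere. Fatou's
  lemma then bounds the distance from its limit \<open>g\<close> to every late \<open>X k\<close>,
  so the whole sequence converges and not only the subsequence.\<close>

instance L2 :: (euclidean_space) complete_space
proof
  fix X :: "nat \<Rightarrow> 'a L2"
  assume X: "Cauchy X"
  have "\<exists>N. \<forall>m\<ge>N. \<forall>k\<ge>N. norm (X m - X k) < (1/2) ^ n" for n
    using X by (auto simp: Cauchy_iff)
  then obtain N where N: "\<And>n m k. m \<ge> N n \<Longrightarrow> k \<ge> N n \<Longrightarrow> norm (X m - X k) < (1/2) ^ n"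
    by metis
  \<comment> \<open>Partial sums make \<open>r m\<close> at least every \<open>N n\<close> with
    \<open>n \<le> m\<close>, so a single index meets all earlier Cauchy thresholds.\<close>
  define r where "r n = (\<Sum>i\<le>n. N i)" for n
  have r: "N n \<le> r m" if "n \<le> m" for n m
    unfolding r_def using that by (intro member_le_sum) auto
  have "\<exists>f. square_integrable f \<and> X n = abs_L2 f" for n
    by (metis L2_cases)
  then obtain f where si: "\<And>n. square_integrable (f n)" and f: "\<And>n. X n = abs_L2 (f n)"
    by metis
  note [measurable] = si[THEN square_integrable_measurable]
  have dist: "(\<integral>\<^sup>+t. ennreal ((cmod (f m t - f k t))\<^sup>2) \<partial>lborel) \<le> ennreal (((1/2) ^ n)\<^sup>2)"
    if "m \<ge> N n" "k \<ge> N n" for m k n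
  proof -
    have "ennreal ((norm (X m - X k))\<^sup>2) \<le> ennreal (((1/2) ^ n)\<^sup>2)"
      using N[OF that] by (intro ennreal_leI power_mono) auto
    then show ?thesis
      by (simp add: f abs_L2_diff si norm_abs_L2 square_integrable_diff)
  qed
  have "AE t in lborel. convergent (\<lambda>n. f (r n) t)"
  proof (rule AE_convergent_of_rapidly_Cauchy)
    show "(\<integral>\<^sup>+t. ennreal ((cmod (f (r (Suc n)) t - f (r n) t))\<^sup>2) \<partial>lborel) \<le> ennreal ((1/4) ^ n)" for n
      using dist[OF r[of n "Suc n"] r[of n n]]
      by (simp add: power2_eq_square power_mult_distrib[symmetric])
  qed simp
  then have lim: "AE t in lborel. (\<lambda>n. f (r n) t) \<longlonglongrightarrow> lim (\<lambda>n. f (r n) t)"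
    by (auto simp: convergent_LIMSEQ_iff)
  define g where "g t = lim (\<lambda>n. f (r n) t)" for t
  have [measurable]: "g \<in> borel_measurable lborel"
    unfolding g_def by measurable
  have dist_g: "(\<integral>\<^sup>+t. ennreal ((cmod (g t - f k t))\<^sup>2) \<partial>lborel) \<le> ennreal (((1/2) ^ n)\<^sup>2)"
    if "k \<ge> N n" for k n
  proof -
    have "(\<integral>\<^sup>+t. ennreal ((cmod (g t - f k t))\<^sup>2) \<partial>lborel)
        = (\<integral>\<^sup>+t. liminf (\<lambda>m. ennreal ((cmod (f (r m) t - f k t))\<^sup>2)) \<partial>lborel)"
    proof (rule nn_integral_cong_AE, use lim in eventually_elim)
      fix t assume "(\<lambda>n. f (r n) t) \<longlonglongrightarrow> lim (\<lambda>n. f (r n) t)"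
      then have "(\<lambda>m. ennreal ((cmod (f (r m) t - f k t))\<^sup>2)) \<longlonglongrightarrow> ennreal ((cmod (g t - f k t))\<^sup>2)"
        unfolding g_def by (intro tendsto_intros)
      then show "ennreal ((cmod (g t - f k t))\<^sup>2) = liminf (\<lambda>m. ennreal ((cmod (f (r m) t - f k t))\<^sup>2))"
        using lim_imp_Liminf[OF sequentially_bot] by metis
    qed
    also have "\<dots> \<le> liminf (\<lambda>m. \<integral>\<^sup>+t. ennreal ((cmod (f (r m) t - f k t))\<^sup>2) \<partial>lborel)"
      by (intro nn_integral_liminf) auto
    also have "\<dots> \<le> ennreal (((1/2) ^ n)\<^sup>2)"
      by (intro Liminf_le eventually_sequentiallyI[of n] dist r that) auto
    finally show ?thesis .
  qed
  have "square_integrable (\<lambda>t. g t - f (N 0) t)"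
    using order.strict_trans1[OF dist_g[of 0 "N 0"]] by (intro square_integrableI) auto
  from square_integrable_add[OF this si[of "N 0"]] have g: "square_integrable g"
    by simp
  have "X \<longlonglongrightarrow> abs_L2 g"
  proof (rule metric_LIMSEQ_I)
    fix e :: real assume "e > 0"
    then obtain n where n: "(1/2) ^ n < e"
      using real_arch_pow_inv[of e "1/2"] by auto
    have "dist (X k) (abs_L2 g) < e" if "k \<ge> N n" for k
    proof -
      have "ennreal ((norm (abs_L2 g - X k))\<^sup>2) \<le> ennreal (((1/2) ^ n)\<^sup>2)"
        using dist_g[OF that] by (simp add: f abs_L2_diff si g norm_abs_L2 square_integrable_diff)
      then have "norm (abs_L2 g - X k) \<le> (1/2) ^ n"
        by (subst (asm) ennreal_le_iff) (auto intro: power2_le_imp_le)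
      then show ?thesis
        using n by (simp add: dist_norm norm_minus_commute)
    qed
    then show "\<exists>no. \<forall>k\<ge>no. dist (X k) (abs_L2 g) < e"
      by blast
  qed
  then show "convergent X"
    by (auto simp: convergent_def)
qed

section \<open>Nearest points and density of total subspaces\<close>

text \<open>Parallelogram law for \<open>x - s m\<close> and \<open>x - s n\<close>: the midpoint of
  \<open>s m\<close> and \<open>s n\<close> stays in \<open>E\<close>, so its squared distance to
  \<open>x\<close> is at least \<open>d\<close>. With both squared distances below
  \<open>d + e^2 / 4\<close>, what remains is less than \<open>e^2\<close>.\<close>

lemma minimizing_sequence_Cauchy:
  fixes x :: "'a::real_inner"
  assumes E: "subspace E" and lb: "\<And>y. y \<in> E \<Longrightarrow> d \<le> (norm (x - y))\<^sup>2"
    and s: "\<And>n. s n \<in> E" "(\<lambda>n. (norm (x - s n))\<^sup>2) \<longlonglongrightarrow> d"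
  shows "Cauchy s"
proof (rule CauchyI)
  fix e :: real assume e: "e > 0"
  then have "eventually (\<lambda>n. (norm (x - s n))\<^sup>2 < d + e\<^sup>2 / 4) sequentially"
    by (intro order_tendstoD(2)[OF s(2)]) simp
  then obtain M where M: "\<And>n. n \<ge> M \<Longrightarrow> (norm (x - s n))\<^sup>2 < d + e\<^sup>2 / 4"
    by (auto simp: eventually_sequentially)
  have "norm (s m - s n) < e" if "m \<ge> M" "n \<ge> M" for m n
  proof -
    have "(1/2) *\<^sub>R (s m + s n) \<in> E"
      by (intro subspace_scale subspace_add E s)
    then have "d \<le> (norm (x - (1/2) *\<^sub>R (s m + s n)))\<^sup>2"
      by (rule lb)
    moreover have "(norm (s m - s n))\<^sup>2
        = 2 * (norm (x - s m))\<^sup>2 + 2 * (norm (x - s n))\<^sup>2 - 4 * (norm (x - (1/2) *\<^sub>R (s m + s n)))\<^sup>2"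
      by (simp add: power2_norm_eq_inner inner_simps inner_commute algebra_simps)
    ultimately have "(norm (s m - s n))\<^sup>2 < e\<^sup>2"
      using M[OF that(1)] M[OF that(2)] by simp
    then show ?thesis
      using e by (simp add: power_less_imp_less_base)
  qed
  then show "\<exists>M. \<forall>m\<ge>M. \<forall>n\<ge>M. norm (s m - s n) < e"
    by blast
qed

text \<open>\<open>E\<close> need not be closed, so a minimizing sequence in \<open>E\<close>
  converges to some \<open>l\<close> in its closure. Minimality forces \<open>x - l\<close> to be
  orthogonal to \<open>E\<close>, and totality gives \<open>x = l\<close>.\<close>

lemma total_subspace_dense:
  fixes E :: "'a::{real_inner, complete_space} set"
  assumes E: "subspace E" and total: "\<And>x. (\<And>y. y \<in> E \<Longrightarrow> x \<bullet> y = 0) \<Longrightarrow> x = 0"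
  shows "closure E = UNIV"
proof -
  have "x \<in> closure E" for x
  proof -
    define D where "D = (\<lambda>y. (norm (x - y))\<^sup>2) ` E"
    have bdd: "bdd_below D"
      by (auto simp: D_def bdd_below_def intro!: exI[of _ 0])
    have ne: "D \<noteq> {}"
      using subspace_0[OF E] by (auto simp: D_def)
    have lb: "Inf D \<le> (norm (x - y))\<^sup>2" if "y \<in> E" for y
      using bdd that by (auto simp: D_def intro: cInf_lower)
    have "\<exists>y\<in>E. (norm (x - y))\<^sup>2 < Inf D + inverse (Suc n)" for n
      using cInf_less_iff[OF ne bdd, of "Inf D + inverse (Suc n)"] by (auto simp: D_def)
    then obtain s where s: "\<And>n. s n \<in> E" and s_lt: "\<And>n. (norm (x - s n))\<^sup>2 < Inf D + inverse (Suc n)"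
      by metis
    have lim: "(\<lambda>n. (norm (x - s n))\<^sup>2) \<longlonglongrightarrow> Inf D"
    proof (rule tendsto_sandwich[OF _ _ tendsto_const])
      show "(\<lambda>n. Inf D + inverse (Suc n)) \<longlonglongrightarrow> Inf D"
        using tendsto_add[OF tendsto_const LIMSEQ_inverse_real_of_nat] by simp
    qed (use lb s s_lt in \<open>auto intro!: always_eventually less_imp_le\<close>)
    have "Cauchy s"
      using minimizing_sequence_Cauchy[OF E lb s lim] .
    then obtain l where l: "s \<longlonglongrightarrow> l"
      by (auto simp: Cauchy_convergent_iff convergent_def)
    then have "(\<lambda>n. (norm (x - s n))\<^sup>2) \<longlonglongrightarrow> (norm (x - l))\<^sup>2"
      by (intro tendsto_intros)
    with lim have d: "(norm (x - l))\<^sup>2 = Inf D"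
      by (rule LIMSEQ_unique[rotated])
    have "x - l = 0"
    proof (rule total)
      fix y assume y: "y \<in> E"
      have "(norm (x - l))\<^sup>2 \<le> (norm (x - l - c *\<^sub>R y))\<^sup>2" for c
      proof -
        have "(\<lambda>n. (norm (x - (s n + c *\<^sub>R y)))\<^sup>2) \<longlonglongrightarrow> (norm (x - (l + c *\<^sub>R y)))\<^sup>2"
          by (intro tendsto_intros l)
        moreover have "Inf D \<le> (norm (x - (s n + c *\<^sub>R y)))\<^sup>2" for n
          by (intro lb subspace_add subspace_scale E s y)
        ultimately show ?thesis
          unfolding d by (intro LIMSEQ_le_const) (auto simp: algebra_simps)
      qed
      then have *: "0 \<le> c\<^sup>2 * (y \<bullet> y) - 2 * c * ((x - l) \<bullet> y)" for c
      proof -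
        define a where "a = x - l"
        have "a \<bullet> a \<le> (a - c *\<^sub>R y) \<bullet> (a - c *\<^sub>R y)"
          using \<open>\<And>c. (norm (x - l))\<^sup>2 \<le> (norm (x - l - c *\<^sub>R y))\<^sup>2\<close>[of c]
          unfolding power2_norm_eq_inner a_def .
        then show ?thesis
          by (simp add: inner_simps inner_commute power2_eq_square algebra_simps flip: a_def)
      qed
      show "(x - l) \<bullet> y = 0"
      proof (cases "y = 0")
        case False
        then have "y \<bullet> y > 0" by simp
        then show ?thesis
          \<comment> \<open>The minimizer of the quadratic in \<open>c\<close>; its value there is
            minus the square of the inner product over \<open>y \<bullet> y\<close>.\<close>
          using *[of "((x - l) \<bullet> y) / (y \<bullet> y)"]
          by (simp add: power2_eq_square field_simps) (auto simp: mult_le_0_iff)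
      qed simp
    qed
    then show ?thesis
      using l s by (auto simp: closure_sequential)
  qed
  then show ?thesis by auto
qed

section \<open>Unitary operators from Gram matrices\<close>

lemma abs_L2_scaleC: "square_integrable f \<Longrightarrow> c *\<^sub>C abs_L2 f = abs_L2 (\<lambda>t. c * f t)"
  by (simp add: scaleC.abs_eq l2_rel_refl)

lemma abs_L2_add:
  "square_integrable f \<Longrightarrow> square_integrable g \<Longrightarrow> abs_L2 f + abs_L2 g = abs_L2 (\<lambda>t. f t + g t)"
  by (simp add: plus_L2.abs_eq l2_rel_refl)

lemma scaleC_scaleC: "c *\<^sub>C d *\<^sub>C (f :: 'a::euclidean_space L2) = (c * d) *\<^sub>C f"
  by transfer (auto simp: l2_rel_def mult.assoc intro!: square_integrable_mult)

lemma scaleC_one [simp]: "1 *\<^sub>C f = f"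
  by transfer (auto simp: l2_rel_def)

lemma scaleC_cancel_cmod1:
  assumes "cmod c = 1" shows "cnj c *\<^sub>C c *\<^sub>C f = f"
  using assms complex_norm_square[of c] by (simp add: scaleC_scaleC mult.commute)

lemma cinner_scaleC_right: "cinner f (c *\<^sub>C g) = cnj c * cinner f g"
  by (subst cinner_commute) (simp add: cinner_scaleC_left flip: cinner_commute[of f g])

lemma cinner_add_right: "cinner f (g + h) = cinner f g + cinner f h"
  by (subst cinner_commute) (simp add: cinner_add_left flip: cinner_commute)

lemma cinner_zero_left [simp]: "cinner 0 g = 0"
  using cinner_add_left[of 0 0 g] by simp

lemma cinner_diff_left: "cinner (f - g) h = cinner f h - cinner g h"
  using cinner_add_left[of "f - g" g h] by simp

lemma cinner_diff_right: "cinner f (g - h) = cinner f g - cinner f h"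
  using cinner_add_right[of f "g - h" h] by simp

text \<open>Links the complex inner product to the real one: continuity carries over, and real
  orthogonality to all complex multiples of a vector becomes complex orthogonality.\<close>

lemma cinner_eq_Complex: "cinner f g = Complex (f \<bullet> g) (f \<bullet> (\<i> *\<^sub>C g))"
  by (simp add: inner_L2_def cinner_scaleC_right complex_eq_iff)

lemma tendsto_cinner_left:
  assumes "(s \<longlongrightarrow> f) F"
  shows "((\<lambda>n. cinner (s n) g) \<longlongrightarrow> cinner f g) F"
  unfolding cinner_eq_Complex by (intro tendsto_Complex tendsto_inner assms tendsto_const)

lemma cinner_eqD:
  fixes e :: "'i \<Rightarrow> 'a::euclidean_space L2"
  assumes "\<And>f. (\<And>i. cinner f (e i) = 0) \<Longrightarrow> f = 0" and "\<And>i. cinner f (e i) = cinner g (e i)"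
  shows "f = g"
  using assms(1)[of "f - g"] assms(2) by (simp add: cinner_diff_left)

text \<open>\<open>h\<close> is the image of \<open>f\<close> under the isometry taking each
  \<open>e i\<close> to \<open>e' i\<close>. Working with the graph \<open>G\<close> of pairs avoids
  checking that linear combinations are mapped consistently: norms agree on \<open>G\<close>, so
  partners of a convergent sequence are Cauchy. The second conclusion later gives preservation of
  inner products, since it compares \<open>h\<close> with any \<open>k'\<close> that has the
  transported coefficients.\<close>

lemma gram_transport:
  fixes e e' :: "'i \<Rightarrow> 'a::euclidean_space L2"
  assumes gram: "\<And>i j. cinner (e i) (e j) = cinner (e' i) (e' j)"
    and total: "\<And>f. (\<And>i. cinner f (e i) = 0) \<Longrightarrow> f = 0"
  obtains h where "\<And>i. cinner h (e' i) = cinner f (e i)"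
    and "\<And>k k'. (\<And>i. cinner k' (e' i) = cinner k (e i)) \<Longrightarrow> cinner h k' = cinner f k"
proof -
  \<comment> \<open>\<open>span\<close> is real, so all complex multiples \<open>c\<close> are put
    into the generating set.\<close>
  define B where "B = range (\<lambda>(c, i). (c *\<^sub>C e i, c *\<^sub>C e' i))"
  define G where "G = span B"
  have transport: "cinner (snd p) k' = cinner (fst p) k"
    if "p \<in> G" and k: "\<And>i. cinner k' (e' i) = cinner k (e i)" for p k k'
    using \<open>p \<in> G\<close> unfolding G_def
  proof (induction rule: span_induct_alt)
    case (step c x y)
    then show ?case
      using k by (auto simp: B_def cinner_add_left scaleR_eq_scaleC cinner_scaleC_left cinner_commute[of k] cinner_commute[of k'])
  qed simp
  have isom: "cinner (snd p) (snd q) = cinner (fst p) (fst q)" if "p \<in> G" "q \<in> G" for p q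
    using that(1)
  proof (rule transport)
    show "cinner (snd q) (e' i) = cinner (fst q) (e i)" for i
      using that(2) by (rule transport) (simp add: gram)
  qed
  have norm_eq: "norm (snd p) = norm (fst p)" if "p \<in> G" for p
    using isom[OF that that] by (simp add: norm_L2_def inner_L2_def)
  have sub: "subspace (fst ` G)"
    unfolding G_def by (intro linear_subspace_image subspace_span linearI) auto
  have "closure (fst ` G) = UNIV"
  proof (rule total_subspace_dense[OF sub], rule total)
    fix x i assume orth: "\<And>y. y \<in> fst ` G \<Longrightarrow> x \<bullet> y = 0"
    have "c *\<^sub>C e i \<in> fst ` G" for c
      by (rule image_eqI[of _ _ "(c *\<^sub>C e i, c *\<^sub>C e' i)"])
         (auto simp: G_def B_def intro!: span_base)
    then show "cinner x (e i) = 0"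
      using orth[of "1 *\<^sub>C e i"] orth[of "\<i> *\<^sub>C e i"] by (simp add: cinner_eq_Complex complex_eq_iff del: scaleC_one) simp
  qed
  then have "f \<in> closure (fst ` G)" by simp
  then obtain s where s: "\<And>n. s n \<in> fst ` G" and lim_s: "s \<longlonglongrightarrow> f"
    by (auto simp: closure_sequential)
  from s have "\<exists>p. p \<in> G \<and> s n = fst p" for n by blast
  then obtain p where p: "\<And>n. p n \<in> G" and sp: "\<And>n. s n = fst (p n)" by metis
  have "Cauchy (\<lambda>n. snd (p n))"
  proof (rule CauchyI)
    fix r :: real assume "r > 0"
    then obtain M where M: "\<And>m n. m \<ge> M \<Longrightarrow> n \<ge> M \<Longrightarrow> norm (s m - s n) < r"
      using LIMSEQ_imp_Cauchy[OF lim_s] by (metis CauchyD)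
    have "norm (snd (p m) - snd (p n)) = norm (s m - s n)" for m n
      using norm_eq[of "p m - p n"] p by (simp add: G_def span_diff sp)
    with M show "\<exists>M. \<forall>m\<ge>M. \<forall>n\<ge>M. norm (snd (p m) - snd (p n)) < r"
      by auto
  qed
  then obtain h where h: "(\<lambda>n. snd (p n)) \<longlonglongrightarrow> h"
    by (auto simp: Cauchy_convergent_iff convergent_def)
  have *: "cinner h k' = cinner f k" if "\<And>i. cinner k' (e' i) = cinner k (e i)" for k k'
  proof (rule LIMSEQ_unique)
    show "(\<lambda>n. cinner (snd (p n)) k') \<longlonglongrightarrow> cinner h k'"
      by (rule tendsto_cinner_left[OF h])
    show "(\<lambda>n. cinner (snd (p n)) k') \<longlonglongrightarrow> cinner f k"
      using tendsto_cinner_left[OF lim_s] transport[OF p that] by (simp add: sp)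
  qed
  show thesis
  proof (rule that[of h])
    show "cinner h (e' i) = cinner f (e i)" for i
      by (rule *) (simp add: gram)
  qed (rule *)
qed

text \<open>The coefficients against the total family \<open>e'\<close> determine a vector, so
  linearity of \<open>U\<close> is uniqueness. Surjectivity is \<open>gram_transport\<close> with
  the two families exchanged.\<close>

lemma unitary_from_gram:
  fixes e e' :: "'i \<Rightarrow> 'a::euclidean_space L2"
  assumes gram: "\<And>i j. cinner (e i) (e j) = cinner (e' i) (e' j)"
    and total: "\<And>f. (\<And>i. cinner f (e i) = 0) \<Longrightarrow> f = 0"
    and total': "\<And>f. (\<And>i. cinner f (e' i) = 0) \<Longrightarrow> f = 0"
  obtains U where "unitary_op U" "\<And>f i. cinner (U f) (e' i) = cinner f (e i)"
proof -
  have "\<exists>h. (\<forall>i. cinner h (e' i) = cinner f (e i)) \<and>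
      (\<forall>k k'. (\<forall>i. cinner k' (e' i) = cinner k (e i)) \<longrightarrow> cinner h k' = cinner f k)" for f
    using gram_transport[of e e' f, OF gram total] by metis
  then obtain U where U: "\<And>f i. cinner (U f) (e' i) = cinner f (e i)"
    and U': "\<And>f k k'. (\<And>i. cinner k' (e' i) = cinner k (e i)) \<Longrightarrow> cinner (U f) k' = cinner f k"
    by metis
  have uniq: "U f = h" if "\<And>i. cinner h (e' i) = cinner f (e i)" for f h
    by (rule cinner_eqD[of e']) (simp_all add: total' U that)
  have "unitary_op U"
    unfolding unitary_op_def
  proof (intro conjI allI)
    show "U (f + g) = U f + U g" for f g
      by (rule uniq) (simp add: cinner_add_left U)
    show "U (c *\<^sub>C f) = c *\<^sub>C U f" for c f
      by (rule uniq) (simp add: cinner_scaleC_left U)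
    show "cinner (U f) (U g) = cinner f g" for f g
      by (rule U') (rule U)
    show "surj U"
      unfolding surj_def
    proof
      fix h
      obtain f where "\<And>i. cinner f (e i) = cinner h (e' i)"
        using gram_transport[of e' e h, OF gram[symmetric] total'] by metis
      then show "\<exists>f. h = U f"
        using uniq by metis
    qed
  qed
  with U show thesis by (rule that[rotated])
qed

section \<open>Gaussians and injectivity of the Fourier transform\<close>

lemma gaussian_fourier_real:
  fixes a b :: real
  assumes a: "a > 0"
  shows "integrable lborel (\<lambda>t. complex_of_real (exp (- a * t\<^sup>2)) * cis (b * t))"
    and "(\<integral>t. complex_of_real (exp (- a * t\<^sup>2)) * cis (b * t) \<partial>lborel)
      = complex_of_real (sqrt (pi / a) * exp (- b\<^sup>2 / (4 * a)))"
proof -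
  \<comment> \<open>The scale at which the standard normal density at \<open>c * t\<close> becomes a
    multiple of \<open>exp (- a * t^2)\<close>; the integral is then the normal characteristic
    function at \<open>b / c\<close>.\<close>
  define c where "c = sqrt (2 * a)"
  have c: "c > 0" "c\<^sup>2 = 2 * a"
    using a by (auto simp: c_def)
  have dens: "std_normal_density (c * t) = exp (- a * t\<^sup>2) / sqrt (2 * pi)" for t
    by (simp add: std_normal_density_def power_mult_distrib c(2))
  have "integrable lborel (\<lambda>t. std_normal_density (0 + c * t))"
    using integrable_std_normal_moment[of 0] c(1) by (intro lborel_integrable_real_affine) auto
  then have "integrable lborel (\<lambda>t. sqrt (2 * pi) * std_normal_density (0 + c * t))"
    by (rule integrable_mult_right)
  then have int: "integrable lborel (\<lambda>t. exp (- a * t\<^sup>2))"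
    by (simp add: dens)
  have [measurable]: "(\<lambda>t. cis (b * t)) \<in> borel_measurable borel" for b
    by (intro borel_measurable_continuous_onI continuous_intros)
  show "integrable lborel (\<lambda>t. complex_of_real (exp (- a * t\<^sup>2)) * cis (b * t))"
    by (rule Bochner_Integration.integrable_bound[OF int]) (measurable, simp add: norm_mult)
  have "complex_of_real (exp (- (b / c)\<^sup>2 / 2)) = char std_normal_distribution (b / c)"
    by (simp add: char_std_normal_distribution)
  also have "\<dots> = (\<integral>x. std_normal_density x *\<^sub>R cis (b / c * x) \<partial>lborel)"
    unfolding char_def by (subst integral_density) (auto simp: cis_conv_exp)
  also have "\<dots> = c *\<^sub>R (\<integral>x. std_normal_density (0 + c * x) *\<^sub>R cis (b / c * (0 + c * x)) \<partial>lborel)"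
    using c(1) by (subst lborel_integral_real_affine[where c = c and t = 0]) auto
  also have "(\<lambda>x. std_normal_density (0 + c * x) *\<^sub>R cis (b / c * (0 + c * x)))
      = (\<lambda>t. complex_of_real (1 / sqrt (2 * pi)) * (complex_of_real (exp (- a * t\<^sup>2)) * cis (b * t)))"
    using c(1) by (auto simp: dens scaleR_conv_of_real)
  finally have "complex_of_real (exp (- (b / c)\<^sup>2 / 2))
      = complex_of_real (c / sqrt (2 * pi)) * (\<integral>t. complex_of_real (exp (- a * t\<^sup>2)) * cis (b * t) \<partial>lborel)"
    by (simp add: scaleR_conv_of_real)
  then have "(\<integral>t. complex_of_real (exp (- a * t\<^sup>2)) * cis (b * t) \<partial>lborel)
      = complex_of_real (sqrt (2 * pi) / c * exp (- (b / c)\<^sup>2 / 2))"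
    using c(1) by (simp add: field_simps)
  also have "sqrt (2 * pi) / c = sqrt (pi / a)"
    by (simp add: c_def real_sqrt_mult real_sqrt_divide)
  also have "- (b / c)\<^sup>2 / 2 = - b\<^sup>2 / (4 * a)"
    by (simp add: power_divide c(2))
  finally show "(\<integral>t. complex_of_real (exp (- a * t\<^sup>2)) * cis (b * t) \<partial>lborel)
      = complex_of_real (sqrt (pi / a) * exp (- b\<^sup>2 / (4 * a)))" .
qed

lemma lborel_integral_prod_coordinates:
  fixes f :: "'a::euclidean_space \<Rightarrow> real \<Rightarrow> complex"
  assumes f: "\<And>j. j \<in> Basis \<Longrightarrow> integrable lborel (f j)"
  shows "integrable lborel (\<lambda>t. \<Prod>j\<in>Basis. f j (t \<bullet> j))"
    and "(\<integral>t. (\<Prod>j\<in>Basis. f j (t \<bullet> j)) \<partial>lborel) = (\<Prod>j\<in>Basis. integral\<^sup>L lborel (f j))"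
proof -
  interpret product_sigma_finite "\<lambda>_::'a. lborel :: real measure" ..
  have [measurable]: "f j \<in> borel_measurable borel" if "j \<in> Basis" for j
    using f[OF that] borel_measurable_integrable by (simp add: borel_measurable_integrable)
  have meas: "(\<lambda>t. \<Prod>j\<in>Basis. f j (t \<bullet> j)) \<in> borel_measurable borel"
    by measurable
  have T: "(\<lambda>x. \<Sum>b\<in>Basis. x b *\<^sub>R b) \<in> (\<Pi>\<^sub>M b\<in>Basis. lborel) \<rightarrow>\<^sub>M (borel :: 'a measure)"
    by measurable
  have coord: "(\<Prod>j\<in>Basis. f j ((\<Sum>b\<in>Basis. x b *\<^sub>R b) \<bullet> j)) = (\<Prod>j\<in>Basis. f j (x j))"
    for x :: "'a \<Rightarrow> real"
    by (intro prod.cong) auto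
  show "integrable lborel (\<lambda>t. \<Prod>j\<in>Basis. f j (t \<bullet> j))"
    by (subst lborel_eq, subst integrable_distr_eq[OF T meas], unfold coord)
       (intro product_integrable_prod f finite_Basis)
  show "(\<integral>t. (\<Prod>j\<in>Basis. f j (t \<bullet> j)) \<partial>lborel) = (\<Prod>j\<in>Basis. integral\<^sup>L lborel (f j))"
    by (subst lborel_eq, subst integral_distr[OF T meas], unfold coord)
       (intro product_integral_prod f finite_Basis)
qed

lemma prod_cis: "finite A \<Longrightarrow> (\<Prod>i\<in>A. cis (f i)) = cis (\<Sum>i\<in>A. f i)"
  by (induction rule: finite_induct) (auto simp: cis_mult)

lemma gaussian_fourier:
  fixes b :: "'a::euclidean_space"
  assumes a: "a > 0"
  shows "integrable lborel (\<lambda>t. complex_of_real (exp (- a * (norm t)\<^sup>2)) * cis (b \<bullet> t))"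
    and "(\<integral>t. complex_of_real (exp (- a * (norm t)\<^sup>2)) * cis (b \<bullet> t) \<partial>lborel)
      = complex_of_real (sqrt (pi / a) ^ DIM('a) * exp (- (norm b)\<^sup>2 / (4 * a)))"
proof -
  let ?f = "\<lambda>j t. complex_of_real (exp (- a * t\<^sup>2)) * cis ((b \<bullet> j) * t)"
  have norm_sq: "(norm x)\<^sup>2 = (\<Sum>j\<in>Basis. (x \<bullet> j)\<^sup>2)" for x :: 'a
    unfolding power2_norm_eq_inner by (subst euclidean_inner) (simp add: power2_eq_square)
  have eq: "(\<Prod>j\<in>Basis. ?f j (t \<bullet> j)) = complex_of_real (exp (- a * (norm t)\<^sup>2)) * cis (b \<bullet> t)" for t
    unfolding prod.distrib
    by (simp add: prod_cis norm_sq sum_distrib_left exp_sum flip: sum_negf of_real_prod)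
       (simp add: euclidean_inner[of b t])
  have prod: "(\<Prod>j\<in>Basis. integral\<^sup>L lborel (?f j))
      = complex_of_real (sqrt (pi / a) ^ DIM('a) * exp (- (norm b)\<^sup>2 / (4 * a)))"
    unfolding gaussian_fourier_real(2)[OF a] of_real_prod[symmetric] prod.distrib
    by (simp add: norm_sq sum_divide_distrib exp_sum flip: sum_negf)
  show "integrable lborel (\<lambda>t. complex_of_real (exp (- a * (norm t)\<^sup>2)) * cis (b \<bullet> t))"
    using lborel_integral_prod_coordinates(1)[of ?f, OF gaussian_fourier_real(1)[OF a]] unfolding eq .
  show "(\<integral>t. complex_of_real (exp (- a * (norm t)\<^sup>2)) * cis (b \<bullet> t) \<partial>lborel)
      = complex_of_real (sqrt (pi / a) ^ DIM('a) * exp (- (norm b)\<^sup>2 / (4 * a)))"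
    using lborel_integral_prod_coordinates(2)[of ?f, OF gaussian_fourier_real(1)[OF a]] 
    unfolding prod eq .
qed

section \<open>Uniqueness for the Fourier transform by Gaussian smoothing\<close>

text \<open>Supplies the integrability for both Fubini exchanges below, where the bounded kernel
  \<open>k\<close> is first a character and then a Gaussian.\<close>

lemma integrable_pair_mult:
  fixes u :: "'a::euclidean_space \<Rightarrow> complex" and g :: "'b::euclidean_space \<Rightarrow> complex"
  assumes u: "integrable lborel u" and g: "integrable lborel g"
    and k [measurable]: "k \<in> borel_measurable (lborel \<Otimes>\<^sub>M lborel)" and k1: "\<And>p. cmod (k p) \<le> 1"
  shows "integrable (lborel \<Otimes>\<^sub>M lborel) (\<lambda>(x, y). u x * g y * k (x, y))"
proof -
  have [measurable]: "u \<in> borel_measurable borel" "g \<in> borel_measurable borel"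
    using u g by (auto dest: borel_measurable_integrable)
  have "integrable (lborel \<Otimes>\<^sub>M lborel) (\<lambda>(x, y). u x * g y)"
  proof (rule lborel_pair.Fubini_integrable)
    show "integrable lborel (\<lambda>x. \<integral>y. norm (case (x, y) of (x, y) \<Rightarrow> u x * g y) \<partial>lborel)"
      unfolding prod.case norm_mult integral_mult_right_zero by (intro integrable_mult_left integrable_norm u)
    show "AE x in lborel. integrable lborel (\<lambda>y. case (x, y) of (x, y) \<Rightarrow> u x * g y)"
      unfolding prod.case by (intro AE_I2 integrable_mult_right g)
  qed measurable
  then show ?thesis
  proof (rule Bochner_Integration.integrable_bound)
    show "AE p in lborel \<Otimes>\<^sub>M lborel.
        norm (case p of (x, y) \<Rightarrow> u x * g y * k (x, y)) \<le> norm (case p of (x, y) \<Rightarrow> u x * g y)"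
      using k1 by (intro AE_I2) (simp add: norm_mult mult_left_le split: prod.split)
  qed measurable
qed

text \<open>A Gaussian is itself a superposition of characters with integrable weight; after
  exchanging the integrals, the inner one is the Fourier transform of \<open>u\<close> at
  \<open>- w\<close>.\<close>

lemma fourier_zero_imp_gaussian_average_zero:
  fixes u :: "'a::euclidean_space \<Rightarrow> complex"
  assumes u: "integrable lborel u" and zero: "\<And>w. (\<integral>t. u t * cis (w \<bullet> t) \<partial>lborel) = 0" and a: "a > 0"
  shows "(\<integral>t. u t * complex_of_real (exp (- a * (norm (y - t))\<^sup>2)) \<partial>lborel) = 0"
proof -
  \<comment> \<open>The Gaussian with parameter \<open>1 / (4 * a)\<close> has Fourier transform
    \<open>C * exp (- a * (norm x)^2)\<close>.\<close>
  define C where "C = complex_of_real (sqrt (4 * pi * a) ^ DIM('a))"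
  have C: "C \<noteq> 0" using a by (simp add: C_def)
  let ?g = "\<lambda>w :: 'a. complex_of_real (exp (- (1 / (4 * a)) * (norm w)\<^sup>2))"
  have g: "integrable lborel ?g"
    using gaussian_fourier(1)[of "1 / (4 * a)" "0 :: 'a"] a by simp
  have expand: "C * complex_of_real (exp (- a * (norm x)\<^sup>2)) = (\<integral>w. ?g w * cis (x \<bullet> w) \<partial>lborel)" for x
    using a by (subst gaussian_fourier(2)) (auto simp: C_def mult_ac)
  have "C * (\<integral>t. u t * complex_of_real (exp (- a * (norm (y - t))\<^sup>2)) \<partial>lborel)
      = (\<integral>t. u t * (C * complex_of_real (exp (- a * (norm (y - t))\<^sup>2))) \<partial>lborel)"
    by (simp flip: integral_mult_right_zero add: mult_ac)
  also have "\<dots> = (\<integral>t. (\<integral>w. u t * ?g w * cis ((y - t) \<bullet> w) \<partial>lborel) \<partial>lborel)"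
    unfolding expand by (simp flip: integral_mult_right_zero add: mult_ac)
  also have "\<dots> = (\<integral>w. (\<integral>t. u t * ?g w * cis ((y - t) \<bullet> w) \<partial>lborel) \<partial>lborel)"
  proof (rule lborel_pair.Fubini_integral[symmetric])
    have "(\<lambda>p :: 'a \<times> 'a. cis ((y - fst p) \<bullet> snd p)) \<in> borel_measurable borel"
      by (intro borel_measurable_continuous_onI continuous_intros)
    then have "(\<lambda>p :: 'a \<times> 'a. cis ((y - fst p) \<bullet> snd p)) \<in> borel_measurable (lborel \<Otimes>\<^sub>M lborel)"
      by (simp add: lborel_prod)
    from integrable_pair_mult[OF u g this]
    show "integrable (lborel \<Otimes>\<^sub>M lborel) (\<lambda>(t, w). u t * ?g w * cis ((y - t) \<bullet> w))"
      by simp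
  qed
  also have "\<dots> = (\<integral>w. ?g w * cis (y \<bullet> w) * (\<integral>t. u t * cis ((- w) \<bullet> t) \<partial>lborel) \<partial>lborel)"
  proof -
    have "cis ((y - t) \<bullet> w) = cis (y \<bullet> w) * cis ((- w) \<bullet> t)" for t w
      by (simp add: cis_mult inner_diff_left inner_commute[of t])
    then have "u t * ?g w * cis ((y - t) \<bullet> w) = ?g w * cis (y \<bullet> w) * (u t * cis ((- w) \<bullet> t))" for t w
      by (simp add: mult_ac)
    then show ?thesis
      by (simp only: integral_mult_right_zero)
  qed
  also have "\<dots> = 0"
    unfolding zero by simp
  finally show ?thesis using C by simp
qed

lemma AE_not_in_frontier_box: "AE t in lborel. t \<notin> frontier (box l (u :: 'a::euclidean_space))"
proof -
  have "frontier (box l u) \<in> null_sets lebesgue"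
    using negligible_convex_frontier[OF convex_box(2)] by (simp add: negligible_iff_null_sets)
  then have "frontier (box l u) \<in> null_sets lborel"
    by (subst (asm) null_sets_completion_iff) auto
  then show ?thesis
    by (rule AE_not_in)
qed

lemma lborel_integral_affine:
  fixes f :: "'a::euclidean_space \<Rightarrow> 'b::{banach, second_countable_topology}"
  assumes [measurable]: "f \<in> borel_measurable borel" and c: "c \<noteq> 0"
  shows "(\<integral>x. f x \<partial>lborel) = \<bar>c\<bar> ^ DIM('a) *\<^sub>R (\<integral>x. f (t + c *\<^sub>R x) \<partial>lborel)"
  by (subst lborel_affine[OF c, of t]) (simp add: integral_density integral_distr)

text \<open>The indicator of the box is mollified by narrowing Gaussians. Each mollified function
  integrates to zero against \<open>u\<close>, and they converge to the indicator off the frontier,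
  which is a null set.\<close>

lemma gaussian_average_zero_imp_box_integral_zero:
  fixes u :: "'a::euclidean_space \<Rightarrow> complex"
  assumes u: "integrable lborel u"
    and zero: "\<And>a y. a > 0 \<Longrightarrow> (\<integral>t. u t * complex_of_real (exp (- a * (norm (y - t))\<^sup>2)) \<partial>lborel) = 0"
  shows "(\<integral>t. u t * indicator (box l r) t \<partial>lborel) = 0"
proof -
  have [measurable]: "u \<in> borel_measurable borel"
    using u by (auto dest: borel_measurable_integrable)
  define \<phi> :: "'a \<Rightarrow> complex" where "\<phi> = indicator (box l r)"
  define e :: "real \<Rightarrow> 'a \<Rightarrow> complex" where "e a x = complex_of_real (exp (- a * (norm x)\<^sup>2))" for a x
  have \<phi> [measurable]: "\<phi> \<in> borel_measurable borel" by (simp add: \<phi>_def)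
  have e_cont: "continuous_on UNIV (\<lambda>x. e a (g x))" if "continuous_on UNIV g" for a and g :: "'c::euclidean_space \<Rightarrow> 'a"
    unfolding e_def by (intro continuous_intros that)
  have [measurable]: "e a \<in> borel_measurable borel" for a
    using borel_measurable_continuous_onI[OF e_cont[OF continuous_on_id]] .
  have \<phi>_int: "integrable lborel \<phi>"
    unfolding \<phi>_def
    by (rule integrable_real_indicator[THEN integrable_of_real, where ?'a = complex, simplified of_real_indicator])
       (use emeasure_bounded_finite[OF bounded_box] in auto)
  \<comment> \<open>The convolution at scale \<open>1 / (n + 1)\<close>, written after rescaling so
    that the weight \<open>e pi\<close> is fixed, has mass 1 and serves as the dominating
    function.\<close>
  define \<psi> where "\<psi> n t = (\<integral>s. \<phi> (t + inverse (Suc n) *\<^sub>R s) * e pi s \<partial>lborel)" for n :: nat and t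
  have int_e: "integrable lborel (e pi)"
    using gaussian_fourier(1)[of pi "0 :: 'a"] by (simp add: e_def[abs_def])
  have e1: "(\<integral>s. e pi s \<partial>lborel) = 1"
    using gaussian_fourier(2)[of pi "0 :: 'a"] by (simp add: e_def)
  have e1': "(\<integral>s. norm (e pi s) \<partial>lborel) = 1"
    using e1 unfolding e_def by (simp add: of_real_eq_1_iff)
  have \<phi>_le: "norm (\<phi> t) \<le> 1" for t
    by (simp add: \<phi>_def indicator_def)
  have [measurable]: "\<psi> n \<in> borel_measurable borel" for n
    unfolding \<psi>_def by measurable
  have \<psi>_le: "norm (\<psi> n t) \<le> 1" for n t
  proof -
    have "norm (\<psi> n t) \<le> (\<integral>s. norm (e pi s) \<partial>lborel)"
      unfolding \<psi>_def using int_e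
      by (intro Bochner_Integration.integral_norm_bound_integral Bochner_Integration.integrable_bound[OF int_e])
         (auto simp: norm_mult intro!: mult_left_le_one_le \<phi>_le)
    then show ?thesis by (simp add: e1')
  qed
  have u\<psi>: "(\<integral>t. u t * \<psi> n t \<partial>lborel) = 0" for n
  proof -
    define c where "c = inverse (real (Suc n))"
    have c: "c > 0" by (simp add: c_def)
    \<comment> \<open>Chosen so that \<open>e a (c *\<^sub>R s) = e pi s\<close>, which undoes the
      rescaling in \<open>\<psi>\<close>.\<close>
    define a where "a = pi / c\<^sup>2"
    have a: "a > 0" using c by (simp add: a_def)
    have \<psi>_eq: "complex_of_real (c ^ DIM('a)) * \<psi> n t = (\<integral>y. \<phi> y * e a (y - t) \<partial>lborel)" for t
    proof -
      have "e a (c *\<^sub>R s) = e pi s" for s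
        using c by (simp add: e_def a_def power_mult_distrib)
      then show ?thesis
        using c unfolding \<psi>_def c_def[symmetric]
        by (subst lborel_integral_affine[where c = c and t = t]) (auto simp: scaleR_conv_of_real)
    qed
    have "complex_of_real (c ^ DIM('a)) * (\<integral>t. u t * \<psi> n t \<partial>lborel)
        = (\<integral>t. u t * (complex_of_real (c ^ DIM('a)) * \<psi> n t) \<partial>lborel)"
      by (simp flip: integral_mult_right_zero add: mult_ac)
    also have "\<dots> = (\<integral>t. (\<integral>y. u t * \<phi> y * e a (y - t) \<partial>lborel) \<partial>lborel)"
      unfolding \<psi>_eq by (simp flip: integral_mult_right_zero add: mult_ac)
    also have "\<dots> = (\<integral>y. (\<integral>t. u t * \<phi> y * e a (y - t) \<partial>lborel) \<partial>lborel)"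
    proof (rule lborel_pair.Fubini_integral[symmetric])
      have "(\<lambda>p :: 'a \<times> 'a. e a (snd p - fst p)) \<in> borel_measurable borel"
        by (intro borel_measurable_continuous_onI e_cont continuous_intros)
      then have "(\<lambda>p :: 'a \<times> 'a. e a (snd p - fst p)) \<in> borel_measurable (lborel \<Otimes>\<^sub>M lborel)"
        by (simp add: lborel_prod)
      from integrable_pair_mult[OF u \<phi>_int this]
      show "integrable (lborel \<Otimes>\<^sub>M lborel) (\<lambda>(t, y). u t * \<phi> y * e a (y - t))"
        using a by (simp add: e_def)
    qed
    also have "\<dots> = (\<integral>y. \<phi> y * (\<integral>t. u t * e a (y - t) \<partial>lborel) \<partial>lborel)"
      by (simp flip: integral_mult_right_zero add: mult_ac)
    also have "\<dots> = 0"
      using zero[OF a] unfolding e_def by simp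
    finally show ?thesis using c by simp
  qed
  have lim: "(\<lambda>n. \<psi> n t) \<longlonglongrightarrow> \<phi> t" if t: "t \<notin> frontier (box l r)" for t
  proof -
    have "(\<lambda>n. \<psi> n t) \<longlonglongrightarrow> (\<integral>s. \<phi> t * e pi s \<partial>lborel)"
      unfolding \<psi>_def
    proof (rule integral_dominated_convergence[where w = "\<lambda>s. norm (e pi s)"])
      show "AE s in lborel. (\<lambda>n. \<phi> (t + inverse (real (Suc n)) *\<^sub>R s) * e pi s) \<longlonglongrightarrow> \<phi> t * e pi s"
      proof (rule AE_I2)
        fix s
        have "(\<lambda>n. t + inverse (real (Suc n)) *\<^sub>R s) \<longlonglongrightarrow> t + 0 *\<^sub>R s"
          by (intro tendsto_intros LIMSEQ_inverse_real_of_nat)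
        then have conv: "(\<lambda>n. t + inverse (real (Suc n)) *\<^sub>R s) \<longlonglongrightarrow> t" by simp
        have "eventually (\<lambda>n. \<phi> (t + inverse (real (Suc n)) *\<^sub>R s) = \<phi> t) sequentially"
        proof (cases "t \<in> box l r")
          case True
          from topological_tendstoD[OF conv open_box this] show ?thesis
            by (rule eventually_mono) (use True in \<open>auto simp: \<phi>_def\<close>)
        next
          case False
          with t have "t \<in> - closure (box l r)"
            using interior_subset by (auto simp: frontier_def)
          from topological_tendstoD[OF conv _ this] show ?thesis
            by (rule eventually_mono) (use False closure_subset in \<open>auto simp: \<phi>_def indicator_def\<close>)
        qed
        then have "(\<lambda>n. \<phi> (t + inverse (real (Suc n)) *\<^sub>R s)) \<longlonglongrightarrow> \<phi> t"
          by (rule tendsto_eventually)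
        then show "(\<lambda>n. \<phi> (t + inverse (real (Suc n)) *\<^sub>R s) * e pi s) \<longlonglongrightarrow> \<phi> t * e pi s"
          by (intro tendsto_intros)
      qed
    qed (use int_e \<phi>_le in \<open>auto simp: norm_mult intro!: mult_left_le_one_le\<close>)
    then show ?thesis by (simp add: e1)
  qed
  have "(\<lambda>n. \<integral>t. u t * \<psi> n t \<partial>lborel) \<longlonglongrightarrow> (\<integral>t. u t * \<phi> t \<partial>lborel)"
  proof (rule integral_dominated_convergence[where w = "\<lambda>t. norm (u t)"])
    show "AE t in lborel. (\<lambda>n. u t * \<psi> n t) \<longlonglongrightarrow> u t * \<phi> t"
      using AE_not_in_frontier_box[of l r] by eventually_elim (intro tendsto_intros lim)
  qed (use u \<psi>_le in \<open>auto simp: norm_mult intro!: mult_left_le\<close>)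
  then show ?thesis
    by (simp add: u\<psi> \<phi>_def LIMSEQ_const_iff)
qed

text \<open>Dynkin's argument: boxes are stable under intersection and generate the Borel sets. The
  whole space is not a box, so its integral enters as the separate hypothesis \<open>total\<close>,
  used for complements.\<close>

lemma box_integral_zero_imp_AE_zero:
  fixes u :: "'a::euclidean_space \<Rightarrow> complex"
  assumes u: "integrable lborel u" and total: "integral\<^sup>L lborel u = 0"
    and zero: "\<And>l r. (\<integral>t. u t * indicator (box l r) t \<partial>lborel) = 0"
  shows "AE t in lborel. u t = 0"
proof (rule sigma_finite_measure.density_zero[OF sigma_finite_lborel u])
  fix A :: "'a set" assume "A \<in> sets lborel"
  then have "A \<in> sigma_sets UNIV (range (\<lambda>(a, b). box a b))"
    by (simp add: borel_eq_box)
  note set_int = integrable_mult_indicator[OF _ u, folded set_integrable_def]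
  have "Int_stable (range (\<lambda>(a, b). box a b :: 'a set))"
    by (auto simp: Int_stable_def box_Int_box)
  moreover have "range (\<lambda>(a, b). box a b :: 'a set) \<subseteq> Pow UNIV"
    by simp
  ultimately show "set_lebesgue_integral lborel A u = 0"
    using \<open>A \<in> sigma_sets _ _\<close>
  proof (induction rule: sigma_sets_induct_disjoint)
    case (basic A)
    then show ?case
      using zero by (auto simp: set_lebesgue_integral_def scaleR_conv_of_real mult.commute of_real_indicator)
  next
    case (compl A)
    then have A: "A \<in> sets borel"
      by (simp add: borel_eq_box)
    have "set_lebesgue_integral lborel UNIV u
        = set_lebesgue_integral lborel (UNIV - A) u + set_lebesgue_integral lborel A u"
      using A by (subst set_integral_Un[symmetric]) (auto intro!: set_int)
    then show ?case
      using compl total by (simp add: set_lebesgue_integral_def)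
  next
    case (union A)
    then have A: "A i \<in> sets borel" for i
      by (auto simp: borel_eq_box)
    have "set_lebesgue_integral lborel (\<Union>i. A i) u = (\<Sum>i. set_lebesgue_integral lborel (A i) u)"
      using A union by (intro lebesgue_integral_countable_add set_int) (auto simp: disjoint_family_on_def)
    then show ?case
      using union by simp
  qed (simp add: set_lebesgue_integral_def)
qed

lemma fourier_zero_imp_AE_zero:
  fixes u :: "'a::euclidean_space \<Rightarrow> complex"
  assumes u: "integrable lborel u" and zero: "\<And>w. (\<integral>t. u t * cis (w \<bullet> t) \<partial>lborel) = 0"
  shows "AE t in lborel. u t = 0"
  using u
proof (rule box_integral_zero_imp_AE_zero)
  show "integral\<^sup>L lborel u = 0"
    using zero[of 0] by simp
qed (intro gaussian_average_zero_imp_box_integral_zero u fourier_zero_imp_gaussian_average_zero zero)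

section \<open>Linear substitutions as unitary operators\<close>

lemma nn_integral_lborel_affine:
  fixes f :: "'a::euclidean_space \<Rightarrow> ennreal"
  assumes [measurable]: "f \<in> borel_measurable borel" and c: "c \<noteq> 0"
  shows "(\<integral>\<^sup>+x. f x \<partial>lborel) = ennreal (\<bar>c\<bar> ^ DIM('a)) * (\<integral>\<^sup>+x. f (t + c *\<^sub>R x) \<partial>lborel)"
  by (subst lborel_affine[OF c, of t]) (simp add: nn_integral_density nn_integral_distr nn_integral_cmult)

text \<open>Uniqueness of Haar measure, by Tonelli's theorem applied to
  \<open>indicator E (N x) * indicator B (N x + y)\<close> with \<open>B\<close> the unit cube.\<close>

lemma distr_lborel_linear_bij:
  fixes N :: "'a::euclidean_space \<Rightarrow> 'a"
  assumes N: "linear N" "bij N"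
  obtains c where "c > 0" "distr lborel borel N = density lborel (\<lambda>_. ennreal c)"
proof -
  have lin_inv: "linear (inv N)"
    using N by (simp add: inj_linear_imp_inv_linear bij_is_inj)
  have meas [measurable]: "N \<in> borel_measurable borel" "inv N \<in> borel_measurable borel"
    using N(1) lin_inv by (auto intro!: borel_measurable_continuous_onI linear_continuous_on simp: linear_linear)
  have inv: "N (inv N x) = x" "inv N (N x) = x" for x
    using \<open>bij N\<close> by (simp_all add: bij_is_surj surj_f_inv_f bij_is_inj)
  define B :: "'a set" where "B = box 0 One"
  have B [measurable]: "B \<in> sets borel" and cube: "emeasure lborel B = 1"
    by (auto simp: B_def emeasure_lborel_box_eq)
  have scale: "emeasure lborel (N -` E) = emeasure lborel (N -` B) * emeasure lborel E"
    if [measurable]: "E \<in> sets borel" for E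
  proof -
    \<comment> \<open>The value \<open>a = 1\<close> gives translation invariance;
      \<open>a = -1\<close> combines it with reflection.\<close>
    have shift: "(\<integral>\<^sup>+y. indicator F (z + a *\<^sub>R y) \<partial>lborel) = emeasure lborel F"
      if "F \<in> sets borel" "\<bar>a\<bar> = 1" for F and z :: 'a and a :: real
      using nn_integral_lborel_affine[of "indicator F" a z] that by auto
    have "emeasure lborel (N -` E) = (\<integral>\<^sup>+x. indicator E (N x) \<partial>lborel)"
      by (subst nn_integral_indicator[symmetric]) (auto simp: indicator_def intro!: nn_integral_cong measurable_sets_borel[of N borel])
    also have "\<dots> = (\<integral>\<^sup>+x. indicator E (N x) * (\<integral>\<^sup>+y. indicator B (N x + 1 *\<^sub>R y) \<partial>lborel) \<partial>lborel)"
      by (subst shift) (auto simp: cube)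
    also have "\<dots> = (\<integral>\<^sup>+x. (\<integral>\<^sup>+y. indicator E (N x) * indicator B (N x + y) \<partial>lborel) \<partial>lborel)"
      by (simp add: nn_integral_cmult)
    also have "\<dots> = (\<integral>\<^sup>+y. (\<integral>\<^sup>+x. indicator E (N x) * indicator B (N x + y) \<partial>lborel) \<partial>lborel)"
      by (rule lborel_pair.Fubini') measurable
    also have "\<dots> = (\<integral>\<^sup>+y. (\<integral>\<^sup>+x. indicator E (N x - y) * indicator B (N x) \<partial>lborel) \<partial>lborel)"
    proof (rule nn_integral_cong)
      fix y
      show "(\<integral>\<^sup>+x. indicator E (N x) * indicator B (N x + y) \<partial>lborel)
          = (\<integral>\<^sup>+x. indicator E (N x - y) * indicator B (N x) \<partial>lborel)"
        by (subst nn_integral_lborel_affine[where c = 1 and t = "- inv N y"])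
           (auto simp: linear_diff[OF N(1)] inv)
    qed
    also have "\<dots> = (\<integral>\<^sup>+x. (\<integral>\<^sup>+y. indicator E (N x - y) * indicator B (N x) \<partial>lborel) \<partial>lborel)"
      by (rule lborel_pair.Fubini') measurable
    also have "\<dots> = (\<integral>\<^sup>+x. (\<integral>\<^sup>+y. indicator E (N x + (-1) *\<^sub>R y) \<partial>lborel) * indicator B (N x) \<partial>lborel)"
      by (simp add: nn_integral_multc)
    also have "\<dots> = emeasure lborel E * (\<integral>\<^sup>+x. indicator B (N x) \<partial>lborel)"
      by (subst shift) (auto simp: nn_integral_cmult)
    also have "(\<integral>\<^sup>+x. indicator B (N x) \<partial>lborel) = emeasure lborel (N -` B)"
      by (subst nn_integral_indicator[symmetric]) (auto simp: indicator_def intro!: nn_integral_cong measurable_sets_borel[of N borel])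
    finally show ?thesis by (simp add: mult.commute)
  qed
  have "bounded (inv N ` B)"
    using lin_inv by (intro bounded_linear_image) (auto simp: B_def linear_linear)
  moreover have "inv N ` B = N -` B"
    using \<open>bij N\<close> by (simp add: bij_vimage_eq_inv_image)
  ultimately have fin: "emeasure lborel (N -` B) < \<infinity>"
    by (auto dest: emeasure_bounded_finite)
  \<comment> \<open>Applying \<open>scale\<close> to the set \<open>inv N -\<close>
    B\<open>writes the measure 1 of the cube as a product containing\<close>emeasure lborel (N
    -\<open>B)\<close>, which therefore cannot vanish.\<close>
  have "N -` (inv N -` B) = B"
    using \<open>bij N\<close> by (auto simp: inv)
  then have "emeasure lborel (N -` B) \<noteq> 0"
    using scale[OF measurable_sets_borel[OF meas(2) B]] cube by auto
  with fin obtain c where c: "c > 0" "emeasure lborel (N -` B) = ennreal c"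
    by (cases "emeasure lborel (N -` B)") (auto simp: ennreal_eq_0_iff less_le)
  show thesis
  proof (rule that[OF c(1)])
    show "distr lborel borel N = density lborel (\<lambda>_. ennreal c)"
      by (rule measure_eqI) (auto simp: emeasure_distr emeasure_density nn_integral_cmult scale c(2))
  qed
qed

lemma unitary_op_weighted_composition:
  fixes N :: "'a::euclidean_space \<Rightarrow> 'a" and m :: "'a \<Rightarrow> complex"
  assumes N: "linear N" "bij N"
    and m [measurable]: "m \<in> borel_measurable borel" and m1: "\<And>t. cmod (m t) = 1"
  obtains U k where "unitary_op U"
    "\<And>f. square_integrable f \<Longrightarrow> square_integrable (\<lambda>t. complex_of_real k * m t * f (N t))"
    "\<And>f. square_integrable f \<Longrightarrow> U (abs_L2 f) = abs_L2 (\<lambda>t. complex_of_real k * m t * f (N t))"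
proof -
  have lin_inv: "linear (inv N)"
    using N by (simp add: inj_linear_imp_inv_linear bij_is_inj)
  have meas [measurable]: "N \<in> borel_measurable borel" "inv N \<in> borel_measurable borel"
    using N(1) lin_inv by (auto intro!: borel_measurable_continuous_onI linear_continuous_on simp: linear_linear)
  have inv: "N (inv N x) = x" "inv N (N x) = x" for x
    using \<open>bij N\<close> by (simp_all add: bij_is_surj surj_f_inv_f bij_is_inj)
  obtain c where c: "c > 0" and distr: "distr lborel borel N = density lborel (\<lambda>_. ennreal c)"
    using distr_lborel_linear_bij[OF N] .
  obtain c' where c': "c' > 0" and distr': "distr lborel borel (inv N) = density lborel (\<lambda>_. ennreal c')"
    using distr_lborel_linear_bij[OF lin_inv bij_imp_bij_inv[OF N(2)]] .
  \<comment> \<open>Compensates the volume factor \<open>c\<close> of the substitution, so that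
    \<open>W\<close> is isometric.\<close>
  define k where "k = 1 / sqrt c"
  have k: "k \<noteq> 0" "complex_of_real k * complex_of_real k * complex_of_real c = 1"
    using c by (auto simp: k_def simp flip: of_real_mult)
  define W where "W f t = complex_of_real k * m t * f (N t)" for f t
  have integrable_comp: "integrable lborel (\<lambda>t. h (M t))"
    if M: "M \<in> borel_measurable borel" "distr lborel borel M = density lborel (\<lambda>_. ennreal b)" "b > 0"
      and h: "integrable lborel h" for M :: "'a \<Rightarrow> 'a" and b and h :: "'a \<Rightarrow> real"
  proof -
    have "integrable (distr lborel borel M) h"
      unfolding M(2) using h \<open>b > 0\<close>
      by (subst integrable_density) (auto dest: borel_measurable_integrable)
    then show ?thesis
      using M(1) h by (subst (asm) integrable_distr_eq) (auto dest: borel_measurable_integrable)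
  qed
  have W: "square_integrable (W f)" if f: "square_integrable f" for f
  proof -
    have "integrable lborel (\<lambda>t. k\<^sup>2 * (cmod (f (N t)))\<^sup>2)"
      using f integrable_comp[OF meas(1) distr c, of "\<lambda>t. (cmod (f t))\<^sup>2"]
      by (intro integrable_mult_right) (auto simp: square_integrable_def)
    moreover have [measurable]: "f \<in> borel_measurable borel"
      using f by (simp add: square_integrable_def)
    moreover have "W f \<in> borel_measurable borel"
      unfolding W_def by measurable
    ultimately show ?thesis
      by (simp add: square_integrable_def W_def norm_mult m1 power_mult_distrib)
  qed
  have cinner_W: "cinner (abs_L2 (W f)) (abs_L2 (W g)) = cinner (abs_L2 f) (abs_L2 g)"
    if f: "square_integrable f" and g: "square_integrable g" for f g
  proof -
    have [measurable]: "f \<in> borel_measurable borel" "g \<in> borel_measurable borel"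
      using f g by (auto simp: square_integrable_def)
    have mm: "m t * cnj (m t) = 1" for t
      using m1[of t] by (simp flip: complex_norm_square)
    have "W f t * cnj (W g t) = (complex_of_real k * complex_of_real k) * (f (N t) * cnj (g (N t)))" for t
      using mm[of t] by (simp add: W_def)
    then have "cinner (abs_L2 (W f)) (abs_L2 (W g))
        = complex_of_real k * complex_of_real k * (\<integral>t. f (N t) * cnj (g (N t)) \<partial>lborel)"
      by (simp only: cinner_abs_L2 W f g integral_mult_right_zero)
    also have "(\<integral>t. f (N t) * cnj (g (N t)) \<partial>lborel) = (\<integral>t. f t * cnj (g t) \<partial>distr lborel borel N)"
      by (subst integral_distr) auto
    also have "\<dots> = complex_of_real c * (\<integral>t. f t * cnj (g t) \<partial>lborel)"
      unfolding distr using c by (subst integral_density) (auto simp: scaleR_conv_of_real)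
    finally show ?thesis
      using k(2) by (simp add: cinner_abs_L2 f g mult.assoc[symmetric])
  qed
  \<comment> \<open>Independence of the representative follows from \<open>cinner_W\<close>: the
    difference of the two images has inner product zero with itself.\<close>
  have cong: "abs_L2 (W f) = abs_L2 (W g)"
    if "square_integrable f" "square_integrable g" "abs_L2 f = abs_L2 g" for f g
  proof -
    have "cinner (abs_L2 (W f) - abs_L2 (W g)) (abs_L2 (W f) - abs_L2 (W g)) = 0"
      using that by (simp add: cinner_diff_left cinner_diff_right cinner_W)
    then show ?thesis
      using inner_eq_zero_iff[of "abs_L2 (W f) - abs_L2 (W g)"] by (simp add: inner_L2_def)
  qed
  have "\<exists>f. square_integrable f \<and> x = abs_L2 f" for x :: "'a L2"
    by (metis L2_cases)
  then obtain rep :: "'a L2 \<Rightarrow> 'a \<Rightarrow> complex" where rep: "\<And>x. square_integrable (rep x)" "\<And>x. abs_L2 (rep x) = x"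
    by metis
  define U where "U x = abs_L2 (W (rep x))" for x
  have U: "U (abs_L2 f) = abs_L2 (W f)" if "square_integrable f" for f
    unfolding U_def by (rule cong) (simp_all add: rep that)
  have "unitary_op U"
    unfolding unitary_op_def
  proof (intro conjI allI)
    show "cinner (U x) (U y) = cinner x y" for x y
      using cinner_W[OF rep(1)[of x] rep(1)[of y]] by (simp add: U_def rep)
    show "U (x + y) = U x + U y" for x y
    proof -
      have "U (x + y) = U (abs_L2 (\<lambda>t. rep x t + rep y t))"
        by (simp add: rep flip: abs_L2_add)
      also have "\<dots> = abs_L2 (\<lambda>t. W (rep x) t + W (rep y) t)"
        by (subst U) (simp_all add: square_integrable_add rep W_def[abs_def] distrib_left)
      finally show ?thesis
        by (simp add: abs_L2_add W rep U_def)
    qed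
    show "U (a *\<^sub>C x) = a *\<^sub>C U x" for a x
    proof -
      have "U (a *\<^sub>C x) = U (abs_L2 (\<lambda>t. a * rep x t))"
        by (simp add: rep flip: abs_L2_scaleC)
      also have "\<dots> = abs_L2 (\<lambda>t. a * W (rep x) t)"
        by (subst U) (simp_all add: square_integrable_mult rep W_def[abs_def] mult_ac)
      finally show ?thesis
        by (simp add: abs_L2_scaleC W rep U_def)
    qed
    show "surj U"
      unfolding surj_def
    proof
      fix y
      \<comment> \<open>The preimage of \<open>rep y\<close> under \<open>W\<close>: since
        \<open>m\<close> has modulus 1, its conjugate is its inverse.\<close>
      define g where "g s = cnj (m (inv N s)) * rep y (inv N s) / complex_of_real k" for s
      have [measurable]: "rep y \<in> borel_measurable borel"
        using rep(1)[of y] by (simp add: square_integrable_def)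
      have "integrable lborel (\<lambda>s. (cmod (rep y (inv N s)))\<^sup>2 / k\<^sup>2)"
        using integrable_comp[OF meas(2) distr' c', of "\<lambda>t. (cmod (rep y t))\<^sup>2"] rep(1)[of y]
        by (intro integrable_divide) (auto simp: square_integrable_def)
      moreover have "g \<in> borel_measurable borel"
        unfolding g_def by measurable
      ultimately have g: "square_integrable g"
        by (simp add: square_integrable_def g_def norm_mult norm_divide m1 power_mult_distrib power_divide)
      have "m t * cnj (m t) = 1" for t
        using m1[of t] by (simp flip: complex_norm_square)
      then have "W g = rep y"
        using k(1) by (simp add: fun_eq_iff W_def g_def inv)
      then show "\<exists>x. y = U x"
        using U[OF g] rep(2) by metis
    qed
  qed
  then show thesis
    using that[of U k] W U unfolding W_def[abs_def] by blast
qed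

section \<open>Time-frequency shifts and coherent states\<close>

lemma time_part_simps [simp]:
  "time_part (z + w) = time_part z + time_part w" "time_part (z - w) = time_part z - time_part w"
  "time_part (- z) = - time_part z" "time_part 0 = 0"
  by (simp_all add: time_part_def vec_eq_iff)

lemma freq_part_simps [simp]:
  "freq_part (z + w) = freq_part z + freq_part w" "freq_part (z - w) = freq_part z - freq_part w"
  "freq_part (- z) = - freq_part z" "freq_part 0 = 0"
  by (simp_all add: freq_part_def vec_eq_iff)

lemma vec_sum_eqI:
  "time_part z = time_part w \<Longrightarrow> freq_part z = freq_part w \<Longrightarrow> z = w"
  by (auto simp: time_part_def freq_part_def vec_eq_iff split_sum_all)

lemma time_freq_surj:
  fixes x \<omega> :: "real^'d::finite"
  obtains z where "time_part z = x" "freq_part z = \<omega>"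
  by (rule that[of "\<chi> i. case i of Inl j \<Rightarrow> x $ j | Inr j \<Rightarrow> \<omega> $ j"])
     (simp_all add: time_part_def freq_part_def)

lemma sum_UNIV_sum:
  "(\<Sum>i\<in>(UNIV :: ('a::finite + 'b::finite) set). f i) = (\<Sum>i\<in>UNIV. f (Inl i)) + (\<Sum>i\<in>UNIV. f (Inr i))"
  unfolding UNIV_Plus_UNIV[symmetric] by (subst sum.Plus) auto

lemma inner_time_freq: "z \<bullet> w = time_part z \<bullet> time_part w + freq_part z \<bullet> freq_part w"
  by (simp add: inner_vec_def sum_UNIV_sum time_part_def freq_part_def)

lemma block_mat_vector:
  fixes A B C D :: "real^'d::finite^'d"
  shows "time_part (block_mat A B C D *v z) = A *v time_part z + B *v freq_part z"
    and "freq_part (block_mat A B C D *v z) = C *v time_part z + D *v freq_part z"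
  by (simp_all add: vec_eq_iff time_part_def freq_part_def block_mat_def matrix_vector_mult_def sum_UNIV_sum)

lemma symp_J_vector:
  "time_part (symp_J *v z) = freq_part z" "freq_part (symp_J *v z) = - time_part z"
  by (simp_all add: symp_J_def block_mat_vector)
     (simp add: vec_eq_iff matrix_vector_mult_def mat_def if_distrib[of uminus] if_distrib[of "\<lambda>c. c * _"] cong: if_cong)

lemma tf_shift_abs_L2:
  assumes "square_integrable f"
  shows "tf_shift z (abs_L2 f) = abs_L2 (\<lambda>t. cis (2 * pi * (t \<bullet> freq_part z)) * f (t - time_part z))"
    and "square_integrable (\<lambda>t. cis (2 * pi * (t \<bullet> freq_part z)) * f (t - time_part z))"
  using tf_shift.abs_eq[OF l2_rel_refl[OF assms], of z]
    tf_shift.rsp[unfolded rel_fun_def, rule_format, OF refl l2_rel_refl[OF assms], of z]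
  by (simp_all add: l2_rel_def)

lemma tf_shift_scaleC: "tf_shift z (c *\<^sub>C f) = c *\<^sub>C tf_shift z f"
proof -
  obtain g where g: "square_integrable g" "f = abs_L2 g" by (rule L2_cases)
  show ?thesis
    by (simp add: g abs_L2_scaleC tf_shift_abs_L2 square_integrable_mult) (simp add: mult_ac)
qed

lemma tf_shift_tf_shift:
  "tf_shift z (tf_shift w f) = cis (- 2 * pi * (time_part z \<bullet> freq_part w)) *\<^sub>C tf_shift (z + w) f"
proof -
  obtain g where g: "square_integrable g" "f = abs_L2 g" by (rule L2_cases)
  have phase: "cis (2 * pi * (t \<bullet> freq_part z)) * (cis (2 * pi * ((t - time_part z) \<bullet> freq_part w)) * x)
      = cis (- 2 * pi * (time_part z \<bullet> freq_part w)) * (cis (2 * pi * (t \<bullet> freq_part (z + w))) * x)" for t x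
    unfolding mult.assoc[symmetric] cis_mult
    by (rule arg_cong[where f = "\<lambda>c. cis c * x"]) (simp add: inner_diff_left inner_add_right algebra_simps)
  have "tf_shift z (tf_shift w f) = abs_L2 (\<lambda>t. cis (2 * pi * (t \<bullet> freq_part z)) *
      (cis (2 * pi * ((t - time_part z) \<bullet> freq_part w)) * g (t - time_part z - time_part w)))"
    by (simp only: g tf_shift_abs_L2)
  also have "\<dots> = abs_L2 (\<lambda>t. cis (- 2 * pi * (time_part z \<bullet> freq_part w)) *
      (cis (2 * pi * (t \<bullet> freq_part (z + w))) * g (t - time_part (z + w))))"
    by (simp only: phase) (simp add: diff_diff_eq)
  also have "\<dots> = cis (- 2 * pi * (time_part z \<bullet> freq_part w)) *\<^sub>C tf_shift (z + w) f"
    by (simp only: g tf_shift_abs_L2 abs_L2_scaleC)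
  finally show ?thesis .
qed

lemma tf_shift_zero [simp]: "tf_shift 0 f = f"
proof -
  obtain g where g: "square_integrable g" "f = abs_L2 g" by (rule L2_cases)
  show ?thesis
    by (simp add: g tf_shift_abs_L2)
qed

lemma cinner_tf_shift: "cinner (tf_shift z f) (tf_shift z g) = cinner f g"
proof -
  obtain f' g' where f: "square_integrable f'" "f = abs_L2 f'" and g: "square_integrable g'" "g = abs_L2 g'"
    by (metis L2_cases)
  have [measurable]: "f' \<in> borel_measurable borel" "g' \<in> borel_measurable borel"
    using f g by (auto simp: square_integrable_def)
  have "cis a * x * cnj (cis a * y) = (cis a * cis (- a)) * (x * cnj y)" for a x y
    by (simp add: cis_cnj mult_ac)
  then have "cis a * x * cnj (cis a * y) = x * cnj y" for a x y
    by (simp add: cis_mult)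
  then have "cinner (tf_shift z f) (tf_shift z g)
      = (\<integral>t. f' (t - time_part z) * cnj (g' (t - time_part z)) \<partial>lborel)"
    by (simp only: f g tf_shift_abs_L2 cinner_abs_L2)
  also have "\<dots> = cinner f g"
    using lborel_integral_affine[of "\<lambda>t. f' t * cnj (g' t)" 1 "- time_part z"]
    by (simp add: f g cinner_abs_L2)
  finally show ?thesis .
qed

text \<open>The symmetric normalisation makes the composition cocycle depend only on the symplectic form.\<close>

definition weyl :: "real^('d::finite + 'd) \<Rightarrow> (real^'d) L2 \<Rightarrow> (real^'d) L2" where
  "weyl z f = cis (- pi * (time_part z \<bullet> freq_part z)) *\<^sub>C tf_shift z f"

lemma weyl_weyl: "weyl z (weyl w f) = cis (- pi * (z \<bullet> (symp_J *v w))) *\<^sub>C weyl (z + w) f"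
  unfolding weyl_def tf_shift_scaleC tf_shift_tf_shift scaleC_scaleC cis_mult
  by (rule arg_cong[where f = "\<lambda>c. cis c *\<^sub>C _"])
     (simp add: inner_time_freq symp_J_vector inner_add_left inner_add_right inner_commute algebra_simps)

lemma weyl_zero [simp]: "weyl 0 f = f"
  by (simp add: weyl_def)

lemma inner_symp_J_self: "z \<bullet> (symp_J *v z) = 0"
  by (simp add: inner_time_freq symp_J_vector inner_commute)

lemma matrix_vector_mult_minus: "A *v (- x) = - (A *v (x :: real^'n::finite))"
  using matrix_vector_mult_scaleR[of A "-1" x] by simp

lemma weyl_minus_weyl [simp]: "weyl (- z) (weyl z f) = f"
  by (simp add: weyl_weyl inner_symp_J_self)

lemma cinner_weyl: "cinner (weyl z f) (weyl z g) = cinner f g"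
  by (simp add: weyl_def cinner_scaleC_left cinner_scaleC_right cinner_tf_shift cis_cnj cis_mult flip: mult.assoc)

lemma cinner_weyl_left: "cinner (weyl z f) g = cinner f (weyl (- z) g)"
  using cinner_weyl[of "- z" "weyl z f" g] by simp

text \<open>A Gram matrix of Weyl orbits splits into a phase given by the symplectic form and one
  function of \<open>z - w\<close>. A map preserving both therefore preserves the whole
  matrix.\<close>

lemma cinner_weyl_weyl:
  "cinner (weyl z f) (weyl w g) = cis (pi * (w \<bullet> (symp_J *v z))) * cinner (weyl (z - w) f) g"
proof -
  have "cinner (weyl z f) (weyl w g) = cinner (weyl (- w) (weyl z f)) g"
    using cinner_weyl[of "- w" "weyl z f" "weyl w g"] by simp
  then show ?thesis
    by (simp add: weyl_weyl cinner_scaleC_left)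
qed

section \<open>The Gaussian and its coherent states\<close>

definition gaussian :: "(real^'d::finite) L2" where
  "gaussian = abs_L2 (\<lambda>t. complex_of_real (exp (- pi * (norm t)\<^sup>2)))"

lemma square_integrable_gaussian:
  "square_integrable (\<lambda>t :: 'a::euclidean_space. complex_of_real (exp (- pi * (norm t)\<^sup>2)))"
proof -
  have "(\<lambda>t :: 'a. complex_of_real (exp (- pi * (norm t)\<^sup>2))) \<in> borel_measurable borel"
    by (intro borel_measurable_continuous_onI continuous_intros)
  moreover have "(exp (- (pi * (norm t)\<^sup>2)))\<^sup>2 = exp (- (2 * pi * (norm t)\<^sup>2))" for t :: 'a
    by (simp flip: exp_double)
  then have "integrable lborel (\<lambda>t :: 'a. (exp (- (pi * (norm t)\<^sup>2)))\<^sup>2)"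
    using integrable_norm[OF gaussian_fourier(1)[of "2 * pi" "0 :: 'a"]] by simp
  ultimately show ?thesis
    by (simp add: square_integrable_def)
qed

lemma cinner_weyl_gaussian:
  fixes z :: "real^('d::finite + 'd)"
  shows "cinner (weyl z gaussian) gaussian
    = complex_of_real (sqrt (1 / 2) ^ CARD('d) * exp (- pi / 2 * (norm z)\<^sup>2))"
proof -
  define x \<omega> where "x = time_part z" and "\<omega> = freq_part z"
  let ?e = "\<lambda>t :: real^'d. complex_of_real (exp (- pi * (norm t)\<^sup>2))"
  let ?F = "\<lambda>t. cis (- pi * (x \<bullet> \<omega>)) * (cis (2 * pi * (t \<bullet> \<omega>)) * ?e (t - x) * ?e t)"
  \<comment> \<open>Centring at the midpoint \<open>x / 2\<close> of the two Gaussians decouples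
    \<open>x\<close> from \<open>s\<close>, and the phase it produces cancels the Weyl
    normalisation.\<close>
  have integrand: "?F ((1/2) *\<^sub>R x + s) = complex_of_real (exp (- pi / 2 * (norm x)\<^sup>2)) *
      (complex_of_real (exp (- (2 * pi) * (norm s)\<^sup>2)) * cis ((2 * pi) *\<^sub>R \<omega> \<bullet> s))" for s
  proof -
    have "- pi * (norm ((1/2) *\<^sub>R x + s - x))\<^sup>2 + - pi * (norm ((1/2) *\<^sub>R x + s))\<^sup>2
        = - pi / 2 * (norm x)\<^sup>2 + - (2 * pi) * (norm s)\<^sup>2"
      by (simp add: power2_norm_eq_inner inner_simps inner_commute algebra_simps)
    then have "exp (- pi * (norm ((1/2) *\<^sub>R x + s - x))\<^sup>2) * exp (- pi * (norm ((1/2) *\<^sub>R x + s))\<^sup>2)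
        = exp (- pi / 2 * (norm x)\<^sup>2) * exp (- (2 * pi) * (norm s)\<^sup>2)"
      unfolding exp_add[symmetric] by simp
    then have "?e ((1/2) *\<^sub>R x + s - x) * ?e ((1/2) *\<^sub>R x + s)
        = complex_of_real (exp (- pi / 2 * (norm x)\<^sup>2)) * complex_of_real (exp (- (2 * pi) * (norm s)\<^sup>2))"
      unfolding of_real_mult[symmetric] by simp
    moreover have "cis (- pi * (x \<bullet> \<omega>)) * cis (2 * pi * (((1/2) *\<^sub>R x + s) \<bullet> \<omega>)) = cis ((2 * pi) *\<^sub>R \<omega> \<bullet> s)"
      by (simp add: cis_mult inner_simps inner_commute algebra_simps)
    moreover have "c * (d * a * b) = p * (q * r)" if "a * b = p * q" "c * d = r" for a b c d p q r :: complex
    proof -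
      have "c * (d * a * b) = (c * d) * (a * b)" by simp
      then show ?thesis by (simp add: that)
    qed
    ultimately show ?thesis
      by blast
  qed
  have "cinner (weyl z gaussian) gaussian = (\<integral>t. ?F t \<partial>lborel)"
    unfolding weyl_def gaussian_def cinner_scaleC_left
    by (subst tf_shift_abs_L2, rule square_integrable_gaussian, subst cinner_abs_L2)
       (simp_all add: tf_shift_abs_L2(2)[OF square_integrable_gaussian, simplified] square_integrable_gaussian[simplified] x_def \<omega>_def)
  also have "\<dots> = (\<integral>s. ?F ((1/2) *\<^sub>R x + s) \<partial>lborel)"
  proof -
    have "?F \<in> borel_measurable borel"
      by (intro borel_measurable_continuous_onI continuous_intros)
    from lborel_integral_affine[OF this, of 1 "(1/2) *\<^sub>R x"] show ?thesis by simp
  qed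
  also have "\<dots> = complex_of_real (exp (- pi / 2 * (norm x)\<^sup>2)) *
      complex_of_real (sqrt (pi / (2 * pi)) ^ DIM(real^'d) * exp (- (norm ((2 * pi) *\<^sub>R \<omega>))\<^sup>2 / (4 * (2 * pi))))"
    unfolding integrand by (subst integral_mult_right_zero, subst gaussian_fourier(2)) simp_all
  also have "\<dots> = complex_of_real (sqrt (1 / 2) ^ CARD('d) * (exp (- pi / 2 * (norm x)\<^sup>2) * exp (- pi / 2 * (norm \<omega>)\<^sup>2)))"
    by (simp add: power_mult_distrib power2_eq_square)
  also have "exp (- pi / 2 * (norm x)\<^sup>2) * exp (- pi / 2 * (norm \<omega>)\<^sup>2) = exp (- pi / 2 * (norm z)\<^sup>2)"
    unfolding exp_add[symmetric] power2_norm_eq_inner inner_time_freq[of z z] x_def \<omega>_def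
    by (simp add: algebra_simps)
  finally show ?thesis .
qed

text \<open>Pure modulations suffice: testing against them says that \<open>g\<close> times the
  Gaussian has vanishing Fourier transform, and the Gaussian has no zeros. The factor
  \<open>1 / (2 * pi)\<close> converts the frequency convention of \<open>tf_shift\<close> to that
  of \<open>cis (w \<bullet> t)\<close>.\<close>

lemma coherent_states_total:
  fixes f :: "(real^'d::finite) L2"
  assumes orth: "\<And>z. cinner f (weyl z gaussian) = 0"
  shows "f = 0"
proof -
  obtain g where g: "square_integrable g" "f = abs_L2 g" by (rule L2_cases)
  let ?e = "\<lambda>t :: real^'d. complex_of_real (exp (- pi * (norm t)\<^sup>2))"
  define u where "u t = g t * ?e t" for t
  have "AE t in lborel. u t = 0"
  proof (rule fourier_zero_imp_AE_zero)
    show "integrable lborel u"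
      using square_integrable_product[OF g(1) square_integrable_gaussian] by (simp add: u_def[abs_def])
    fix w :: "real^'d"
    obtain z where z: "time_part z = 0" "freq_part z = - (1 / (2 * pi)) *\<^sub>R w"
      by (rule time_freq_surj)
    have "weyl z gaussian = abs_L2 (\<lambda>t. cis (- (w \<bullet> t)) * ?e t)"
      "square_integrable (\<lambda>t. cis (- (w \<bullet> t)) * ?e t)"
      using tf_shift_abs_L2[OF square_integrable_gaussian, of z]
      by (simp_all add: weyl_def z gaussian_def inner_commute[of w])
    then have "(\<integral>t. g t * cnj (cis (- (w \<bullet> t)) * ?e t) \<partial>lborel) = 0"
      using orth[of z] g by (simp add: cinner_abs_L2)
    then show "(\<integral>t. u t * cis (w \<bullet> t) \<partial>lborel) = 0"
      by (simp add: u_def cis_cnj mult_ac)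
  qed
  then have "AE t in lborel. g t = 0"
    by (rule eventually_mono) (simp add: u_def)
  then show ?thesis
    using abs_L2_eq_iff[OF g(1) square_integrable_zero] by (simp add: g(2) zero_L2_def)
qed

section \<open>Metaplectic operators\<close>

text \<open>Only a projective intertwining is asked for; leaving the phase \<open>c\<close> free
  keeps the notion closed under products without tracking cocycles.\<close>

definition metaplectic :: "real^('d::finite + 'd)^('d + 'd) \<Rightarrow> bool" where
  "metaplectic S \<longleftrightarrow> (\<exists>(U :: (real^'d) L2 \<Rightarrow> (real^'d) L2) c. unitary_op U \<and> (\<forall>z. cmod (c z) = 1) \<and>
     (\<forall>z f. U (tf_shift z f) = c z *\<^sub>C tf_shift (S *v z) (U f)))"

lemma metaplecticI:
  assumes "unitary_op U" "\<And>z. cmod (c z) = 1"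
    "\<And>z f. U (tf_shift z f) = c z *\<^sub>C tf_shift (S *v z) (U f)"
  shows "metaplectic S"
  using assms unfolding metaplectic_def by blast

lemma unitary_opD:
  assumes "unitary_op U"
  shows "U (f + g) = U f + U g" "U (c *\<^sub>C f) = c *\<^sub>C U f" "surj U" "cinner (U f) (U g) = cinner f g"
  using assms by (auto simp: unitary_op_def)

lemma metaplectic_mult:
  assumes "metaplectic S" "metaplectic T"
  shows "metaplectic (S ** T)"
proof -
  obtain U c where U: "unitary_op U" "\<And>z. cmod (c z) = 1"
    "\<And>z f. U (tf_shift z f) = c z *\<^sub>C tf_shift (S *v z) (U f)"
    using assms(1) unfolding metaplectic_def by blast
  obtain V d where V: "unitary_op V" "\<And>z. cmod (d z) = 1"
    "\<And>z f. V (tf_shift z f) = d z *\<^sub>C tf_shift (T *v z) (V f)"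
    using assms(2) unfolding metaplectic_def by blast
  have "unitary_op (U \<circ> V)"
    using comp_surj[OF unitary_opD(3)[OF V(1)] unitary_opD(3)[OF U(1)]]
    by (simp add: unitary_op_def unitary_opD[OF U(1)] unitary_opD[OF V(1)])
  then show ?thesis
    by (rule metaplecticI[where c = "\<lambda>z. d z * c (T *v z)"])
       (simp_all add: norm_mult U V unitary_opD(2)[OF U(1)] scaleC_scaleC matrix_vector_mul_assoc)
qed

lemma inner_matrix_vector: "(A *v x) \<bullet> y = x \<bullet> (transpose A *v (y :: real^'n::finite))"
  using dot_lmul_matrix[of x "transpose A" y] by simp

lemma symplectic_inner:
  assumes "symplectic S"
  shows "(S *v z) \<bullet> (symp_J *v (S *v w)) = z \<bullet> (symp_J *v w)"
  using assms unfolding inner_matrix_vector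
  by (simp add: matrix_vector_mul_assoc symplectic_def matrix_mul_assoc)

text \<open>An orthogonal symplectic matrix preserves the Gram matrix of the coherent states.\<close>

lemma metaplectic_orthogonal:
  fixes S :: "real^('d::finite + 'd)^('d + 'd)"
  assumes S: "symplectic S" and orth: "transpose S ** S = mat 1"
  shows "metaplectic S"
proof -
  have "(norm (S *v z))\<^sup>2 = (norm z)\<^sup>2" for z
    by (simp add: power2_norm_eq_inner inner_matrix_vector matrix_vector_mul_assoc orth)
  then have ambiguity: "cinner (weyl (S *v z) gaussian) gaussian = cinner (weyl z gaussian) gaussian" for z
    by (simp add: cinner_weyl_gaussian)
  have S_inv: "S *v (transpose S *v z) = z" for z
    using orth by (simp add: matrix_vector_mul_assoc matrix_left_right_inverse del: transpose_matrix_vector)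
  have total: "f = 0" if orth: "\<And>z. cinner f (weyl (S *v z) gaussian) = 0" for f :: "(real^'d) L2"
  proof (rule coherent_states_total)
    fix w show "cinner f (weyl w gaussian) = 0"
      using orth[of "transpose S *v w"] unfolding S_inv .
  qed
  obtain U where U: "unitary_op U"
    and U_weyl: "\<And>f z. cinner (U f) (weyl (S *v z) gaussian) = cinner f (weyl z gaussian)"
  proof (rule unitary_from_gram[of "\<lambda>z. weyl z gaussian" "\<lambda>z. weyl (S *v z) gaussian"])
    show "cinner (weyl z gaussian) (weyl w gaussian)
        = cinner (weyl (S *v z) gaussian) (weyl (S *v w) gaussian)" for z w
      unfolding cinner_weyl_weyl by (simp add: symplectic_inner[OF S] ambiguity flip: matrix_vector_mult_diff_distrib)
    show "f = 0" if "\<And>z. cinner f (weyl z gaussian) = 0" for f :: "(real^'d) L2"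
      using that by (rule coherent_states_total)
    show "f = 0" if "\<And>z. cinner f (weyl (S *v z) gaussian) = 0" for f :: "(real^'d) L2"
      using that by (rule total)
  qed blast
  \<comment> \<open>Both sides have the same coefficients against the transported coherent states,
    because \<open>S\<close> preserves the cocycle in \<open>weyl_weyl\<close>.\<close>
  have intertwine: "U (weyl w f) = weyl (S *v w) (U f)" for w f
  proof (rule cinner_eqD[of "\<lambda>z. weyl (S *v z) gaussian"])
    show "f = 0" if "\<And>z. cinner f (weyl (S *v z) gaussian) = 0" for f :: "(real^'d) L2"
      using that by (rule total)
    fix z
    have "cinner (weyl (S *v w) (U f)) (weyl (S *v z) gaussian)
        = cinner (U f) (weyl (S *v (- w)) (weyl (S *v z) gaussian))"
      by (simp add: cinner_weyl_left matrix_vector_mult_minus)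
    also have "\<dots> = cinner f (weyl (- w) (weyl z gaussian))"
      by (simp add: weyl_weyl[of "S *v (- w)"] weyl_weyl[of "- w"] symplectic_inner[OF S] cinner_scaleC_right U_weyl
          flip: matrix_vector_right_distrib)
    finally show "cinner (U (weyl w f)) (weyl (S *v z) gaussian)
        = cinner (weyl (S *v w) (U f)) (weyl (S *v z) gaussian)"
      by (simp add: U_weyl cinner_weyl_left)
  qed
  \<comment> \<open>The exponent separating \<open>weyl\<close> from \<open>tf_shift\<close>; its
    change from \<open>z\<close> to \<open>S *v z\<close> is the phase of the intertwining.\<close>
  define q where "q z = - pi * (time_part z \<bullet> freq_part z)" for z :: "real^('d + 'd)"
  have tf: "tf_shift z f = cis (- q z) *\<^sub>C weyl z f" for z :: "real^('d + 'd)" and f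
    by (simp add: weyl_def q_def scaleC_scaleC cis_mult)
  have "U (tf_shift z f) = cis (q (S *v z) - q z) *\<^sub>C tf_shift (S *v z) (U f)" for z f
    by (simp add: tf unitary_opD(2)[OF U] intertwine scaleC_scaleC cis_mult)
  then show ?thesis
    using U by (intro metaplecticI[of U "\<lambda>z. cis (q (S *v z) - q z)"]) auto
qed

text \<open>Chirp multiplications and dilations are both weighted composition operators.\<close>

lemma metaplectic_weighted_composition:
  fixes S :: "real^('d::finite + 'd)^('d + 'd)" and N :: "real^'d^'d"
  assumes N: "invertible N" and p: "continuous_on UNIV p"
    and time: "\<And>z. N *v time_part (S *v z) = time_part z"
    and phase: "\<And>t z. p t + 2 * pi * ((N *v t) \<bullet> freq_part z)
        = r z + 2 * pi * (t \<bullet> freq_part (S *v z)) + p (t - time_part (S *v z))"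
  shows "metaplectic S"
proof -
  have lin: "linear ((*v) N)" by simp
  have bij: "bij ((*v) N)"
    using N by (simp add: invertible_eq_bij)
  have meas: "(\<lambda>t. cis (p t)) \<in> borel_measurable borel"
    by (intro borel_measurable_continuous_onI continuous_intros p)
  obtain U k where U: "unitary_op U"
    and si: "\<And>f. square_integrable f \<Longrightarrow> square_integrable (\<lambda>t. complex_of_real k * cis (p t) * f (N *v t))"
    and Uf: "\<And>f. square_integrable f \<Longrightarrow> U (abs_L2 f) = abs_L2 (\<lambda>t. complex_of_real k * cis (p t) * f (N *v t))"
    using unitary_op_weighted_composition[OF lin bij meas] by (auto simp: that)
  have "U (tf_shift z f) = cis (r z) *\<^sub>C tf_shift (S *v z) (U f)" for z f
  proof -
    obtain g where g: "square_integrable g" "f = abs_L2 g" by (rule L2_cases)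
    have "U (tf_shift z f) = abs_L2 (\<lambda>t. complex_of_real k * cis (p t) *
        (cis (2 * pi * ((N *v t) \<bullet> freq_part z)) * g (N *v t - time_part z)))"
      by (simp only: g tf_shift_abs_L2 Uf)
    also have "\<dots> = abs_L2 (\<lambda>t. cis (r z) * (cis (2 * pi * (t \<bullet> freq_part (S *v z))) *
        (complex_of_real k * cis (p (t - time_part (S *v z))) * g (N *v (t - time_part (S *v z))))))"
    proof (rule arg_cong[where f = abs_L2], rule ext)
      fix t
      have "cis (p t) * cis (2 * pi * ((N *v t) \<bullet> freq_part z))
          = cis (r z) * cis (2 * pi * (t \<bullet> freq_part (S *v z))) * cis (p (t - time_part (S *v z)))"
        unfolding cis_mult phase ..
      moreover have "N *v (t - time_part (S *v z)) = N *v t - time_part z"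
        by (simp add: matrix_vector_mult_diff_distrib time)
      moreover have "k' * a * (b * x) = c * (d * (k' * e * x))" if "a * b = c * d * e" for a b c d e k' x :: complex
      proof -
        have "k' * a * (b * x) = (a * b) * (k' * x)" by simp
        also have "\<dots> = c * (d * (k' * e * x))" unfolding that by simp
        finally show ?thesis .
      qed
      ultimately show "complex_of_real k * cis (p t) * (cis (2 * pi * ((N *v t) \<bullet> freq_part z)) * g (N *v t - time_part z))
          = cis (r z) * (cis (2 * pi * (t \<bullet> freq_part (S *v z))) *
            (complex_of_real k * cis (p (t - time_part (S *v z))) * g (N *v (t - time_part (S *v z)))))"
        by metis
    qed
    also have "\<dots> = cis (r z) *\<^sub>C tf_shift (S *v z) (U f)"
      by (simp only: g Uf si tf_shift_abs_L2 abs_L2_scaleC[OF tf_shift_abs_L2(2)[OF si[OF g(1)]]])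
    finally show ?thesis .
  qed
  then show ?thesis
    using U by (intro metaplecticI[of U "\<lambda>z. cis (r z)"]) auto
qed

text \<open>For \<open>p t = pi * (t \<bullet> (P *v t))\<close> with \<open>P\<close> symmetric,
  \<open>p t - p (t - x)\<close> is linear in \<open>t\<close> up to a constant: the linear part
  shears the frequency by \<open>P *v x\<close>, and the constant is \<open>r\<close>.\<close>

lemma metaplectic_chirp:
  fixes P :: "real^'d::finite^'d"
  assumes P: "transpose P = P"
  shows "metaplectic (block_mat (mat 1) 0 P (mat 1))"
proof (rule metaplectic_weighted_composition[where N = "mat 1" and p = "\<lambda>t. pi * (t \<bullet> (P *v t))"
      and r = "\<lambda>z. - pi * (time_part z \<bullet> (P *v time_part z))"])
  have sym: "(P *v x) \<bullet> y = x \<bullet> (P *v y)" for x y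
    using inner_matrix_vector[of P x y] by (simp add: P)
  show "pi * (t \<bullet> (P *v t)) + 2 * pi * ((mat 1 *v t) \<bullet> freq_part z)
    = - pi * (time_part z \<bullet> (P *v time_part z)) + 2 * pi * (t \<bullet> freq_part (block_mat (mat 1) 0 P (mat 1) *v z))
      + pi * ((t - time_part (block_mat (mat 1) 0 P (mat 1) *v z)) \<bullet> (P *v (t - time_part (block_mat (mat 1) 0 P (mat 1) *v z))))" for t z
    using sym[of "time_part z" t]
    by (simp add: block_mat_vector matrix_vector_mult_diff_distrib inner_diff_left inner_diff_right inner_add_right
        inner_commute[of "P *v _"] algebra_simps)
  show "continuous_on UNIV (\<lambda>t. pi * (t \<bullet> (P *v t)))"
    by (intro continuous_intros matrix_vector_mult_linear_continuous_on)
qed (simp_all add: block_mat_vector invertible_def)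

text \<open>Substituting \<open>transpose M *v t\<close> sends frequencies through \<open>M\<close>
  and time shifts through the inverse of \<open>transpose M\<close>, which is
  \<open>L\<close>.\<close>

lemma metaplectic_dilation:
  fixes L M :: "real^'d::finite^'d"
  assumes left_inv: "transpose L ** M = mat 1"
  shows "metaplectic (block_mat L 0 0 M)"
proof (rule metaplectic_weighted_composition[where N = "transpose M" and p = "\<lambda>t. 0" and r = "\<lambda>z. 0"])
  have inv_L: "transpose M ** L = mat 1"
    using left_inv by (metis matrix_transpose_mul transpose_mat transpose_transpose)
  show "invertible (transpose M)"
    using inv_L invertible_right_inverse by blast
  show "transpose M *v time_part (block_mat L 0 0 M *v z) = time_part z" for z
    by (simp add: block_mat_vector matrix_vector_mul_assoc inv_L)
  show "0 + 2 * pi * ((transpose M *v t) \<bullet> freq_part z)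
    = 0 + 2 * pi * (t \<bullet> freq_part (block_mat L 0 0 M *v z)) + 0" for t z
    by (simp add: block_mat_vector dot_lmul_matrix)
qed simp

section \<open>Symplectic matrices are metaplectic\<close>

lemma block_mat_mult:
  fixes A B C D A' B' C' D' :: "real^'d::finite^'d"
  shows "block_mat A B C D ** block_mat A' B' C' D' =
    block_mat (A ** A' + B ** C') (A ** B' + B ** D') (C ** A' + D ** C') (C ** B' + D ** D')"
  unfolding matrix_eq
  by (intro allI vec_sum_eqI)
     (simp_all add: block_mat_vector matrix_vector_right_distrib matrix_vector_mult_add_rdistrib
       add.assoc add.left_commute flip: matrix_vector_mul_assoc)

lemma block_mat_eq_iff:
  fixes A B C D A' B' C' D' :: "real^'d::finite^'d"
  shows "block_mat A B C D = block_mat A' B' C' D' \<longleftrightarrow> A = A' \<and> B = B' \<and> C = C' \<and> D = D'"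
  by (auto simp: block_mat_def vec_eq_iff split_sum_all)

lemma block_mat_cases:
  fixes S :: "real^('d::finite + 'd)^('d + 'd)"
  obtains A B C D :: "real^'d^'d" where "S = block_mat A B C D"
  by (rule that[of "\<chi> i j. S $ Inl i $ Inl j" "\<chi> i j. S $ Inl i $ Inr j"
        "\<chi> i j. S $ Inr i $ Inl j" "\<chi> i j. S $ Inr i $ Inr j"])
     (simp add: block_mat_def vec_eq_iff split_sum_all)

lemma transpose_block_mat:
  fixes A B C D :: "real^'d::finite^'d"
  shows "transpose (block_mat A B C D) = block_mat (transpose A) (transpose C) (transpose B) (transpose D)"
  by (simp add: block_mat_def transpose_def vec_eq_iff split_sum_all)

lemma block_mat_one: "block_mat (mat 1) 0 0 (mat 1) = (mat 1 :: real^('d::finite + 'd)^('d + 'd))"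
  by (simp add: block_mat_def mat_def vec_eq_iff split_sum_all)

lemma matrix_mul_minus:
  fixes A B :: "real^'d::finite^'d"
  shows "(- A) ** B = - (A ** B)" "A ** (- B) = - (A ** B)"
  by (simp_all add: matrix_matrix_mult_def vec_eq_iff sum_negf)

lemma transpose_minus: "transpose (- A :: real^'n::finite^'m::finite) = - transpose A"
  by (simp add: transpose_def vec_eq_iff)

lemma transpose_add: "transpose (A + B :: real^'n::finite^'m::finite) = transpose A + transpose B"
  by (simp add: transpose_def vec_eq_iff)

lemma matrix_add_rdistrib:
  fixes A B C :: "real^'d::finite^'d"
  shows "(A + B) ** C = A ** C + B ** C"
  by (simp add: matrix_matrix_mult_def vec_eq_iff sum.distrib distrib_right)

lemma transpose_zero [simp]: "transpose (0 :: real^'n::finite^'m::finite) = 0"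
  by (simp add: transpose_def vec_eq_iff)

lemma matrix_mul_zero [simp]:
  fixes A :: "real^'d::finite^'d"
  shows "0 ** A = 0" "A ** 0 = 0"
  by (simp_all add: matrix_matrix_mult_def vec_eq_iff)

text \<open>The last two equations are transposes of each other: the first form solves for
  \<open>D\<close>, the second controls the common kernel of \<open>A\<close> and
  \<open>C\<close>.\<close>

lemma symplectic_block_mat:
  fixes A B C D :: "real^'d::finite^'d"
  shows "symplectic (block_mat A B C D) \<longleftrightarrow>
    transpose A ** C = transpose C ** A \<and> transpose B ** D = transpose D ** B \<and>
    transpose A ** D = mat 1 + transpose C ** B \<and> transpose D ** A = mat 1 + transpose B ** C"
proof -
  have "X - Y = - Z \<longleftrightarrow> Y = Z + X" for X Y Z :: "real^'d^'d"
    by (metis minus_diff_eq minus_minus diff_eq_eq)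
  then show ?thesis
    unfolding symplectic_def symp_J_def transpose_block_mat block_mat_mult block_mat_eq_iff
    by (simp add: matrix_mul_minus diff_eq_eq conj_ac)
qed

lemma symplectic_mult:
  assumes "symplectic S" "symplectic T"
  shows "symplectic (S ** T)"
proof -
  have "transpose (S ** T) ** symp_J ** (S ** T) = transpose T ** (transpose S ** symp_J ** S) ** T"
    by (simp add: matrix_transpose_mul matrix_mul_assoc)
  then show ?thesis
    using assms by (simp add: symplectic_def)
qed

lemma uminus_symp_J:
  "- symp_J = (block_mat 0 (- mat 1) (mat 1) 0 :: real^('d::finite + 'd)^('d + 'd))"
  by (simp add: symp_J_def block_mat_def vec_eq_iff split_sum_all)

lemma metaplectic_symp_J:
  "metaplectic (symp_J :: real^('d::finite + 'd)^('d + 'd))"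
  "metaplectic (- symp_J :: real^('d::finite + 'd)^('d + 'd))"
proof -
  show "metaplectic (symp_J :: real^('d::finite + 'd)^('d + 'd))"
    by (rule metaplectic_orthogonal; unfold symp_J_def symplectic_block_mat)
       (simp_all add: transpose_block_mat block_mat_mult block_mat_one[symmetric] transpose_minus matrix_mul_minus)
  show "metaplectic (- symp_J :: real^('d::finite + 'd)^('d + 'd))"
    unfolding uminus_symp_J
    by (rule metaplectic_orthogonal; (unfold symplectic_block_mat)?)
       (simp_all add: transpose_block_mat block_mat_mult block_mat_one[symmetric] transpose_minus matrix_mul_minus)
qed

text \<open>Conjugating a chirp by the Fourier transform gives the upper triangular generators.\<close>

lemma metaplectic_upper:
  fixes Q :: "real^'d::finite^'d"
  assumes "transpose Q = Q"
  shows "metaplectic (block_mat (mat 1) Q 0 (mat 1))"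
proof -
  have "block_mat (mat 1) Q 0 (mat 1) = - symp_J ** block_mat (mat 1) 0 (- Q) (mat 1) ** symp_J"
    unfolding uminus_symp_J by (simp add: symp_J_def block_mat_mult matrix_mul_minus)
  moreover have "metaplectic (block_mat (mat 1) 0 (- Q) (mat 1))"
    using assms by (intro metaplectic_chirp) (simp add: transpose_minus)
  ultimately show ?thesis
    using metaplectic_symp_J by (auto intro!: metaplectic_mult)
qed

text \<open>Block elimination with pivot \<open>A\<close>: \<open>P\<close> and \<open>Q\<close> are
  the multipliers and \<open>transpose Ai\<close> is the Schur complement. The symplectic equations
  make \<open>P\<close> and \<open>Q\<close> symmetric, so the outer factors are shears already
  covered.\<close>

lemma metaplectic_of_invertible_block:
  fixes A B C D :: "real^'d::finite^'d"
  assumes S: "symplectic (block_mat A B C D)" and A: "invertible A"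
  shows "metaplectic (block_mat A B C D)"
proof -
  obtain Ai where Ai: "A ** Ai = mat 1" "Ai ** A = mat 1"
    using A by (auto simp: invertible_def)
  have AiT: "transpose Ai ** transpose A = mat 1" "transpose A ** transpose Ai = mat 1"
    using Ai by (simp_all flip: matrix_transpose_mul add: transpose_mat)
  have AC: "transpose A ** C = transpose C ** A" and BD: "transpose B ** D = transpose D ** B"
    and AD: "transpose A ** D = mat 1 + transpose C ** B"
    using S unfolding symplectic_block_mat by auto
  define P where "P = C ** Ai"
  define Q where "Q = Ai ** B"
  have "transpose P = transpose Ai ** (transpose C ** A) ** Ai"
    by (simp add: P_def matrix_transpose_mul Ai flip: matrix_mul_assoc)
  also have "\<dots> = P"
    unfolding AC[symmetric] by (simp add: matrix_mul_assoc AiT P_def)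
  finally have P: "transpose P = P" .
  have "D = transpose Ai ** (transpose A ** D)"
    by (simp add: matrix_mul_assoc AiT)
  also have "\<dots> = transpose Ai + transpose P ** B"
    unfolding AD by (simp add: matrix_add_ldistrib P_def matrix_transpose_mul matrix_mul_assoc)
  finally have D: "D = transpose Ai + P ** B"
    by (simp add: P)
  \<comment> \<open>Inserting \<open>D\<close> into
    \<open>transpose B ** D = transpose D ** B\<close> produces the same symmetric term on both
    sides; cancelling it leaves the symmetry of \<open>Q\<close>.\<close>
  have "transpose Q + transpose B ** P ** B = transpose B ** D"
    by (simp add: D Q_def matrix_transpose_mul matrix_add_ldistrib matrix_mul_assoc)
  also have "\<dots> = Q + transpose B ** P ** B"
    unfolding BD by (simp add: D Q_def transpose_add matrix_transpose_mul matrix_add_rdistrib P matrix_mul_assoc)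
  finally have Q: "transpose Q = Q" by simp
  have "A ** Q = B" "P ** A = C"
    by (simp_all add: P_def Q_def matrix_mul_assoc Ai) (simp add: Ai flip: matrix_mul_assoc)
  then have "block_mat A B C D = block_mat (mat 1) 0 P (mat 1) ** block_mat A 0 0 (transpose Ai) ** block_mat (mat 1) Q 0 (mat 1)"
    by (simp add: block_mat_mult block_mat_eq_iff D add.commute) (metis matrix_mul_assoc)
  moreover have "metaplectic (block_mat A 0 0 (transpose Ai))"
    by (rule metaplectic_dilation) (rule AiT)
  ultimately show ?thesis
    using metaplectic_chirp[OF P] metaplectic_upper[OF Q] by (auto intro!: metaplectic_mult)
qed

text \<open>If \<open>x\<close> and \<open>y\<close> are in the kernels of \<open>A + s C\<close> and \<open>A + t C\<close> with \<open>s \<noteq> t\<close>, then \<open>C x\<close> and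
  \<open>C y\<close> are orthogonal, so at most \<open>CARD('d)\<close> values of \<open>t\<close> are singular.\<close>

lemma exists_invertible_add_scaleR:
  fixes A C :: "real^'d::finite^'d"
  assumes sym: "transpose A ** C = transpose C ** A"
    and ker: "\<And>x. A *v x = 0 \<Longrightarrow> C *v x = 0 \<Longrightarrow> x = 0"
  obtains t where "invertible (A + t *\<^sub>R C)"
proof (rule ccontr)
  assume "\<not> thesis"
  then have "\<exists>x. x \<noteq> 0 \<and> (A + t *\<^sub>R C) *v x = 0" for t
    using that[of t] by (auto simp: invertible_left_inverse matrix_left_invertible_ker)
  then obtain x where x0: "\<And>t. x t \<noteq> 0" and x: "\<And>t. (A + t *\<^sub>R C) *v x t = 0"
    by metis
  have Ax: "A *v x t = - t *\<^sub>R (C *v x t)" for t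
    using x[of t] by (simp add: matrix_vector_mult_add_rdistrib eq_neg_iff_add_eq_0 flip: scaleR_matrix_vector_assoc)
  have Cx: "C *v x t \<noteq> 0" for t
    using ker[of "x t"] x0[of t] Ax[of t] by auto
  have orth: "(C *v x s) \<bullet> (C *v x t) = 0" if "s \<noteq> t" for s t
  proof -
    have "(A *v x s) \<bullet> (C *v x t) = x s \<bullet> ((transpose A ** C) *v x t)"
      by (simp add: inner_matrix_vector matrix_vector_mul_assoc del: transpose_matrix_vector)
    also have "\<dots> = (C *v x s) \<bullet> (A *v x t)"
      unfolding sym by (simp add: inner_matrix_vector matrix_vector_mul_assoc del: transpose_matrix_vector)
    finally show ?thesis
      using that by (simp add: Ax)
  qed
  \<comment> \<open>\<open>{..CARD('d)}\<close> contains both endpoints, so it yields one more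
    nonzero orthogonal vector than the dimension allows.\<close>
  define V where "V = (\<lambda>n. C *v x (real n)) ` {..CARD('d)}"
  have "inj_on (\<lambda>n. C *v x (real n)) {..CARD('d)}"
  proof (rule inj_onI)
    fix m n assume eq: "C *v x (real m) = C *v x (real n)"
    show "m = n"
      using orth[of "real m" "real n"] Cx[of "real n"] eq by (cases "m = n") auto
  qed
  then have "card V = CARD('d) + 1"
    by (simp add: V_def card_image)
  moreover have "independent V"
  proof (rule pairwise_orthogonal_independent)
    show "pairwise orthogonal V"
      using orth by (auto simp: pairwise_def orthogonal_def V_def) (metis of_nat_eq_iff)
    show "0 \<notin> V"
      using Cx by (auto simp: V_def)
  qed
  ultimately show False
    using independent_bound[of V] by simp
qed

lemma metaplectic_of_symplectic:
  fixes S :: "real^('d::finite + 'd)^('d + 'd)"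
  assumes S: "symplectic S"
  shows "metaplectic S"
proof -
  obtain A B C D :: "real^'d^'d" where ABCD: "S = block_mat A B C D"
    by (rule block_mat_cases)
  have AC: "transpose A ** C = transpose C ** A" and DA: "transpose D ** A = mat 1 + transpose B ** C"
    using S unfolding ABCD symplectic_block_mat by auto
  \<comment> \<open>By \<open>DA\<close>, \<open>x\<close> equals \<open>transpose D ** A\<close>
    minus \<open>transpose B ** C\<close> applied to \<open>x\<close>, and both terms
    vanish.\<close>
  have "x = 0" if "A *v x = 0" "C *v x = 0" for x
  proof -
    have "(transpose D ** A) *v x = (mat 1 + transpose B ** C) *v x"
      unfolding DA ..
    then show ?thesis
      using that by (simp add: matrix_vector_mult_add_rdistrib flip: matrix_vector_mul_assoc)
  qed
  then obtain t where t: "invertible (A + t *\<^sub>R C)"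
    using exists_invertible_add_scaleR[OF AC] by blast
  let ?T = "\<lambda>s. block_mat (mat 1) (s *\<^sub>R mat 1) 0 (mat 1) :: real^('d + 'd)^('d + 'd)"
  have sym: "transpose (s *\<^sub>R mat 1 :: real^'d^'d) = s *\<^sub>R mat 1" for s
    by (simp add: transpose_scalar)
  have scale: "(s *\<^sub>R mat 1) ** M = s *\<^sub>R M" for s and M :: "real^'d^'d"
    by (simp flip: scalar_matrix_assoc)
  have "symplectic (?T t)"
    by (simp add: symplectic_block_mat sym)
  then have "symplectic (?T t ** S)"
    using S by (rule symplectic_mult)
  then have "metaplectic (?T t ** S)"
    unfolding ABCD block_mat_mult using t by (intro metaplectic_of_invertible_block) (simp_all add: scale)
  moreover have "metaplectic (?T (- t))"
    by (rule metaplectic_upper) (rule sym)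
  moreover have "S = ?T (- t) ** (?T t ** S)"
    by (simp add: ABCD block_mat_mult scale matrix_mul_minus)
  ultimately show ?thesis
    by (metis metaplectic_mult)
qed

section \<open>Transport of Gabor systems by an intertwining unitary\<close>

lemma unitary_op_bounded_linear:
  assumes U: "unitary_op U"
  shows "bounded_linear U" "bounded_linear (inv U)" "inv U (U f) = f" "U (inv U f) = f"
    "cinner (inv U f) g = cinner f (U g)" "norm (inv U f) = norm f"
proof -
  note [simp] = unitary_opD[OF U]
  have norm: "norm (U f) = norm f" for f
    by (simp add: norm_L2_def inner_L2_def)
  have lin: "linear U"
    by (rule linearI) (simp_all add: scaleR_eq_scaleC)
  have inj: "inj U"
    using lin norm by (auto simp: linear_injective_0) (metis norm_eq_zero)
  show inv: "U (inv U f) = f" "inv U (U f) = f" for f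
    using inj by (simp_all add: surj_f_inv_f)
  show "bounded_linear U"
    using lin norm by (intro bounded_linear_intro[where K = 1]) (auto simp: linear_add linear_scale)
  show norm_inv: "norm (inv U f) = norm f" for f
    using norm[of "inv U f"] by (simp add: inv)
  show "bounded_linear (inv U)"
  proof (rule bounded_linear_intro[where K = 1])
    show "inv U (f + g) = inv U f + inv U g" for f g
      by (metis inv linear_add[OF lin])
    show "inv U (r *\<^sub>R f) = r *\<^sub>R inv U f" for f r
      by (metis inv linear_scale[OF lin])
  qed (simp add: norm_inv)
  show "cinner (inv U f) g = cinner f (U g)"
    using unitary_opD(4)[OF U, of "inv U f" g] by (simp add: inv)
qed

lemma gabor_unitarily_equivalent_metaplectic:
  fixes S :: "real^('d::finite + 'd)^('d + 'd)"
  assumes S: "metaplectic S" and inj: "inj ((*v) S)"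
  shows "gabor_unitarily_equivalent \<Lambda> ((*v) S ` \<Lambda>)"
proof -
  obtain U c where U: "unitary_op U" and c: "\<And>z. cmod (c z) = 1"
    and Utf: "\<And>z f. U (tf_shift z f) = c z *\<^sub>C tf_shift (S *v z) (U f)"
    using S unfolding metaplectic_def by blast
  note Ub = unitary_op_bounded_linear[OF U]
  have inj': "inj_on ((*v) S) \<Lambda>"
    using inj by (rule inj_on_subset) simp
  have tf: "tf_shift (S *v z) (U f) = cnj (c z) *\<^sub>C U (tf_shift z f)" for z f
    by (simp add: Utf scaleC_cancel_cmod1 c)
  have coeff: "cinner f (tf_shift (S *v z) (U g)) = c z * cinner (inv U f) (tf_shift z g)" for z f g
    by (simp add: tf cinner_scaleC_right Ub(5))
  have "gabor_bessel (U g) ((*v) S ` \<Lambda>) \<longleftrightarrow> gabor_bessel g \<Lambda>" for g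
  proof -
    have "gabor_bessel (U g) ((*v) S ` \<Lambda>) \<longleftrightarrow> (\<exists>C>0. \<forall>f.
        (\<lambda>z. (cmod (cinner (inv U f) (tf_shift z g)))\<^sup>2) summable_on \<Lambda> \<and>
        (\<Sum>\<^sub>\<infinity>z\<in>\<Lambda>. (cmod (cinner (inv U f) (tf_shift z g)))\<^sup>2) \<le> C * (norm (inv U f))\<^sup>2)"
      unfolding gabor_bessel_def summable_on_reindex[OF inj'] infsum_reindex[OF inj'] o_def
      by (simp add: coeff norm_mult c Ub(6))
    \<comment> \<open>As \<open>f\<close> ranges over all of \<open>L2\<close>, so does
      \<open>inv U f\<close>, with the same norm.\<close>
    also have "\<dots> \<longleftrightarrow> gabor_bessel g \<Lambda>"
      unfolding gabor_bessel_def by (metis Ub(3))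
    finally show ?thesis .
  qed
  moreover have "frame_operator ((*v) S ` \<Lambda>) (U g) (U h) = U \<circ> frame_operator \<Lambda> g h \<circ> inv U" for g h
  proof
    fix f
    have summand: "cinner f (tf_shift (S *v z) (U g)) *\<^sub>C tf_shift (S *v z) (U h)
        = U (cinner (inv U f) (tf_shift z g) *\<^sub>C tf_shift z h)" for z
    proof -
      have "c z * cinner (inv U f) (tf_shift z g) * cnj (c z) = cinner (inv U f) (tf_shift z g)"
        using c[of z] complex_norm_square[of "c z"] by (simp add: mult_ac)
      then show ?thesis
        unfolding coeff unitary_opD(2)[OF U] by (simp only: tf scaleC_scaleC)
    qed
    have "frame_operator ((*v) S ` \<Lambda>) (U g) (U h) f
        = (\<Sum>\<^sub>\<infinity>z\<in>\<Lambda>. U (cinner (inv U f) (tf_shift z g) *\<^sub>C tf_shift z h))"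
      unfolding frame_operator_def infsum_reindex[OF inj'] o_def summand ..
    \<comment> \<open>\<open>inv U\<close> carries summability back, so the two series are summable
      together; otherwise both take the default value 0 of \<open>infsum\<close>, which
      \<open>U\<close> fixes.\<close>
    also have "\<dots> = U (frame_operator \<Lambda> g h (inv U f))"
      unfolding frame_operator_def
      by (intro infsum_bounded_linear_strong summable_on_bounded_linear_iff[OF Ub(1,2)] Ub(1,3))
    finally show "frame_operator ((*v) S ` \<Lambda>) (U g) (U h) f = (U \<circ> frame_operator \<Lambda> g h \<circ> inv U) f"
      by simp
  qed
  ultimately show ?thesis
    unfolding gabor_unitarily_equivalent_def using U by blast
qed

theorem corollary3p10:
  fixes A :: "real^('d::finite + 'd)^('d + 'd)" and K :: "real^'d^'d"
  assumes "invertible A"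
    and "invertible K"
    and "transpose A ** symp_J ** A = block_mat 0 K (- transpose K) 0"
  shows "separable_lattice (lattice_of (block_mat (mat 1) 0 0 K))
    \<and> symplectically_related (lattice_of A) (lattice_of (block_mat (mat 1) 0 0 K))
    \<and> gabor_unitarily_equivalent (lattice_of A) (lattice_of (block_mat (mat 1) 0 0 K))"
proof -
  let ?D = "block_mat (mat 1 :: real^'d^'d) 0 0 K"
  obtain Ai where Ai: "A ** Ai = mat 1" "Ai ** A = mat 1"
    using assms(1) by (auto simp: invertible_def)
  obtain Ki where Ki: "Ki ** K = mat 1"
    using assms(2) by (auto simp: invertible_def)
  define S where "S = ?D ** Ai"
  \<comment> \<open>Both bases give the same form, so changing from one to the other by
    \<open>S = ?D ** Ai\<close> preserves \<open>symp_J\<close>.\<close>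
  have "transpose ?D ** symp_J ** ?D = transpose A ** symp_J ** A"
    unfolding assms(3) by (simp add: symp_J_def transpose_block_mat block_mat_mult matrix_mul_minus)
  then have "transpose S ** symp_J ** S = transpose Ai ** (transpose A ** symp_J ** A) ** Ai"
    by (simp add: S_def matrix_transpose_mul flip: matrix_mul_assoc) (simp add: matrix_mul_assoc)
  also have "\<dots> = transpose (A ** Ai) ** symp_J ** (A ** Ai)"
    by (simp add: matrix_transpose_mul matrix_mul_assoc)
  finally have S: "symplectic S"
    by (simp add: symplectic_def Ai)
  \<comment> \<open>Inverting \<open>?D\<close> blockwise gives the left inverse of
    \<open>S\<close>; its injectivity lets sums over the image lattice be reindexed.\<close>
  have "block_mat (mat 1) 0 0 Ki ** ?D = mat 1"
    by (simp add: block_mat_mult Ki block_mat_one)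
  then have "(A ** block_mat (mat 1) 0 0 Ki) ** S = mat 1"
    unfolding S_def by (metis Ai(1) matrix_mul_assoc matrix_mul_lid)
  then have inj: "inj ((*v) S)"
    using matrix_left_invertible_injective by blast
  have "S *v (A *v m) = ?D *v m" for m
    unfolding S_def by (simp add: matrix_vector_mul_assoc Ai flip: matrix_mul_assoc)
  then have lattice: "lattice_of ?D = (*v) S ` lattice_of A"
    by (simp add: lattice_of_def image_image)
  have "separable_lattice (lattice_of ?D)"
    unfolding separable_lattice_def using assms(2) by (intro exI[of _ "mat 1"] exI[of _ K]) (auto simp: invertible_def)
  moreover have "symplectically_related (lattice_of A) (lattice_of ?D)"
    unfolding symplectically_related_def lattice using S by blast
  moreover have "gabor_unitarily_equivalent (lattice_of A) (lattice_of ?D)"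
    unfolding lattice by (rule gabor_unitarily_equivalent_metaplectic[OF metaplectic_of_symplectic[OF S] inj])
  ultimately show ?thesis by blast
qed

end
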